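(* Let $X=(X_t)_{t\ge 0}$ be a time-homogeneous continuous-time Markov process on a countable set $S$, started in a fixed state $i\in S$, with transition probabilities $p_t(i,j)$, and let $L^i_t=\int_0^t\delta_i(X_s)\,ds$. Put $G_\infty(i,i)=\int_0^\infty p_s(i,i)\,ds\in[0,\infty]$ and $\hat p(\lambda)=\int_0^\infty e^{-\lambda s}p_s(i,i)\,ds$ for $\lambda>0$. Then the following hold. (1) If $\gamma>\frac{1}{G_\infty(i,i)}$, then $\hat p^{-1}(1/\gamma)>0$ and, as $t\to\infty$, $$\mathbb{E}^i\big[e^{\gamma L^i_t}\big]\sim \frac{1}{\hat p^{-1}(1/\gamma)\,\gamma\int_0^\infty s\,e^{-\hat p^{-1}(1/\gamma)s}p_s(i,i)\,ds}\;e^{\hat p^{-1}(1/\gamma)t}.$$ (2) If $\gamma>0$ and $\gamma=\frac{1}{G_\infty(i,i)}$, then $$\mathbb{E}^i\big[e^{\gamma L^i_t}\big]\approx \frac{t}{\gamma\int_0^t\int_s^\infty p_r(i,i)\,dr\,ds}$$ with weak asymptotic bounds $1$ and $2$; that is, with $g(t)$ denoting the right-hand side, $$1\le\liminf_{t\to\infty}\frac{\mathbb{E}^i[e^{\gamma L^i_t}]}{g(t)}\le\limsup_{t\to\infty}\frac{\mathbb{E}^i[e^{\gamma L^i_t}]}{g(t)}\le 2.$$ If moreover $H_\infty(i,i)=\int_0^\infty s\,p_s(i,i)\,ds<\infty$, then, as $t\to\infty$, $$\mathbb{E}^i\big[e^{\gamma L^i_t}\big]\sim\frac{t}{\gamma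 H_\infty(i,i)}.$$ (3) If $0\le\gamma<\frac{1}{G_\infty(i,i)}$, then $$\lim_{t\to\infty}\mathbb{E}^i\big[e^{\gamma L^i_t}\big]=\frac{1}{1-\gamma G_\infty(i,i)}.$$
   Context: Here $p_t(i,j)=\mathbb{P}[X_t=j\mid X_0=i]$ for $i,j\in S$, and $\mathbb{E}^i$ denotes expectation for the process with $X_0=i$. The function $\delta_i$ is the indicator of the state $i$ ($\delta_i(x)=1$ if $x=i$ and $0$ otherwise), so $L^i_t$ is the time $X$ spends at $i$ up to time $t$. The conventions $1/\infty=0$ and $1/0=\infty$ are used for $1/G_\infty(i,i)$. When $G_\infty(i,i)>0$, the Laplace transform $\hat p$ is finite, continuous and strictly decreasing on $(0,\infty)$ with range $(0,G_\infty(i,i))$, and $\hat p^{-1}$ denotes its inverse function; thus for $\gamma>1/G_\infty(i,i)$, $\hat p^{-1}(1/\gamma)$ is the unique $\lambda>0$ with $\int_0^\infty e^{-\lambda s}p_s(i,i)\,ds=1/\gamma$. For functions $f,g$ of $t$, $f\sim g$ means $\lim_{t\to\infty}f(t)/g(t)=1$, and $f\approx g$ means that there are constants $C_1,C_2$ with $C_1\le\liminf_{t\to\infty} f(t)/g(t)\le\limsup_{t\to\infty} f(t)/g(t)\le C_2$. *)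

theory Defs
  imports "HOL-Probability.Probability" "HOL-Library.Landau_Symbols"
begin

(* P x is the law started in x, and X is one process on the common measurable space \<Omega>.
   No path regularity is assumed: joint measurability on [0,\<infinity>) \<times> \<Omega> is what makes occupation
   times well-defined random variables.  Values of X at negative times are irrelevant.
   In the Markov property T is the finite set of observed past times, s its maximum and
   a the observed values; homogeneity is expressed by the right-hand side not depending
   on s. *)
locale markov_process =
  fixes S :: "'s set"
    and \<Omega> :: "'w measure"
    and P :: "'s \<Rightarrow> 'w measure"
    and X :: "real \<Rightarrow> 'w \<Rightarrow> 's"
  assumes countable_states: "countable S"
    and prob_space_P: "\<And>x. x \<in> S \<Longrightarrow> prob_space (P x)"
    and sets_P: "\<And>x. x \<in> S \<Longrightarrow> sets (P x) = sets \<Omega>"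
    and measurable_X:
      "(\<lambda>(t, \<omega>). X t \<omega>) \<in> restrict_space borel {0..} \<Otimes>\<^sub>M \<Omega> \<rightarrow>\<^sub>M count_space S"
    and initial_state: "\<And>x. x \<in> S \<Longrightarrow> AE \<omega> in P x. X 0 \<omega> = x"
    and markov_property:
      "\<And>x y s t T a. x \<in> S \<Longrightarrow> y \<in> S \<Longrightarrow> 0 \<le> t \<Longrightarrow> finite T \<Longrightarrow> T \<subseteq> {0..s} \<Longrightarrow> s \<in> T \<Longrightarrow>
         \<P>(\<omega> in P x. \<forall>r\<in>T. X r \<omega> = a r) > 0 \<Longrightarrow>
         \<P>(\<omega> in P x. X (s + t) \<omega> = y \<bar> \<forall>r\<in>T. X r \<omega> = a r)
           = \<P>(\<omega> in P (a s). X t \<omega> = y)"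

definition trans_prob ::
  "('s \<Rightarrow> 'w measure) \<Rightarrow> (real \<Rightarrow> 'w \<Rightarrow> 's) \<Rightarrow> real \<Rightarrow> 's \<Rightarrow> 's \<Rightarrow> real" where
  "trans_prob P X t x y = \<P>(\<omega> in P x. X t \<omega> = y)"

definition occ_time :: "(real \<Rightarrow> 'w \<Rightarrow> 's) \<Rightarrow> 's \<Rightarrow> real \<Rightarrow> 'w \<Rightarrow> real" where
  "occ_time X i t \<omega> = (LINT s:{0..t}|lborel. indicator {i} (X s \<omega>))"

definition exp_moment ::
  "('s \<Rightarrow> 'w measure) \<Rightarrow> (real \<Rightarrow> 'w \<Rightarrow> 's) \<Rightarrow> 's \<Rightarrow> real \<Rightarrow> real \<Rightarrow> real" where
  "exp_moment P X i \<gamma> t = prob_space.expectation (P i) (\<lambda>\<omega>. exp (\<gamma> * occ_time X i t \<omega>))"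

definition green :: "('s \<Rightarrow> 'w measure) \<Rightarrow> (real \<Rightarrow> 'w \<Rightarrow> 's) \<Rightarrow> 's \<Rightarrow> ennreal" where
  "green P X i = (\<integral>\<^sup>+ s\<in>{0..}. ennreal (trans_prob P X s i i) \<partial>lborel)"

definition green_moment :: "('s \<Rightarrow> 'w measure) \<Rightarrow> (real \<Rightarrow> 'w \<Rightarrow> 's) \<Rightarrow> 's \<Rightarrow> ennreal" where
  "green_moment P X i = (\<integral>\<^sup>+ s\<in>{0..}. ennreal (s * trans_prob P X s i i) \<partial>lborel)"

definition laplace :: "('s \<Rightarrow> 'w measure) \<Rightarrow> (real \<Rightarrow> 'w \<Rightarrow> 's) \<Rightarrow> 's \<Rightarrow> real \<Rightarrow> real" where
  "laplace P X i l = (LINT s:{0..}|lborel. exp (- l * s) * trans_prob P X s i i)"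

definition laplace_inv :: "('s \<Rightarrow> 'w measure) \<Rightarrow> (real \<Rightarrow> 'w \<Rightarrow> 's) \<Rightarrow> 's \<Rightarrow> real \<Rightarrow> real" where
  "laplace_inv P X i = the_inv_into {0<..} (laplace P X i)"

end

theory Submission
  imports Defs
begin

text \<open>
  Write \<open>p s\<close> for the probability of being in \<open>i\<close> at time \<open>s\<close> and \<open>M t\<close> for the exponential moment
  of the occupation time up to \<open>t\<close>.  Differentiating \<open>exp (\<gamma> L)\<close> along a path and applying the
  Markov property at the times spent in \<open>i\<close> shows that \<open>M\<close> solves the renewal equation
  \<open>M t = 1 + \<gamma> \<integral>\<^sub>0\<^sup>t p s M (t - s) ds\<close> (lemma \<open>exp_moment_renewal\<close>).  Only finite-dimensional
  distributions are available, so the Markov property is used one power of the occupation time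
  at a time: \<open>nn_integral_stay_occupation_power\<close> computes all moments by induction, and the
  exponential series is summed afterwards.

  The three regimes differ in the total mass \<open>\<gamma> G\<close> of the kernel \<open>\<gamma> p\<close>.

  If the mass is below 1, then \<open>M\<close> is monotone and bounded, and its limit \<open>m\<close> solves
  \<open>m = 1 + \<gamma> G m\<close> (\<open>subcritical_limit\<close>).

  In the other two cases the equation takes the form \<open>h = z + f * h\<close> with a probability density
  \<open>f\<close>: for mass 1 directly, for mass above 1 after multiplication by \<open>exp (- l t)\<close>, where
  \<open>l\<close> is the point at which the Laplace transform of \<open>p\<close> equals \<open>1 / \<gamma>\<close>.  Everything then
  follows from one conservation law (\<open>conservation\<close>): with \<open>tail s\<close> the mass that \<open>f\<close> puts beyond
  \<open>s\<close>, the integral of \<open>tail s * h (t - s)\<close> over \<open>s\<close> equals the integral of \<open>z\<close> up to \<open>t\<close>.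

  In the critical case \<open>z = 1\<close> and \<open>h = M\<close> is nondecreasing.  With \<open>A a\<close> the integral of \<open>tail\<close>
  over \<open>[0, a]\<close>, the conservation law at time \<open>t\<close> gives \<open>t \<le> M t * A t\<close>, and at time \<open>t + a\<close> it
  gives \<open>M t * A a \<le> t + a\<close>.  Taking \<open>a = t\<close> yields the constants 1 and 2; letting \<open>a\<close> tend to
  infinity after \<open>t\<close> yields the exact asymptotics when the mean is finite.

  In the supercritical case \<open>h t = exp (- l t) M t\<close> is bounded and Lipschitz, and \<open>z\<close> is
  integrable.  Because \<open>f\<close> is a probability density, the renewal equation gives
  \<open>\<integral> f s (h (t - s) - h t)\<^sup>2 ds = (f * h\<^sup>2) t - (h t)\<^sup>2 + 2 h t z t\<close>.  Convolution with \<open>f\<close> does not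
  increase the integral over an initial interval, so the left-hand side is integrable in \<open>t\<close>
  (\<open>quadratic_bound\<close>).  Hence \<open>h (t - s) - h t\<close> tends to 0 for almost every \<open>s\<close> with
  \<open>f s > 0\<close>.  The shifts with this property form a group; it is uncountable, hence dense, and the
  Lipschitz bound extends it to all real shifts.  So \<open>h\<close> is asymptotically constant on bounded
  windows, and the conservation law identifies the constant as the integral of \<open>z\<close> divided by
  the mean of \<open>f\<close> (\<open>key_renewal_lipschitz\<close>).
\<close>

section \<open>Integrals over the real line\<close>

lemma nn_integral_lborel_translate:
  fixes f :: "real \<Rightarrow> ennreal"
  assumes [measurable]: "f \<in> borel_measurable borel"
  shows "(\<integral>\<^sup>+x. f (x + c) \<partial>lborel) = (\<integral>\<^sup>+x. f x \<partial>lborel)"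
  using nn_integral_real_affine[of f 1 c] by (simp add: add.commute)

lemma nn_integral_lborel_reflect:
  fixes f :: "real \<Rightarrow> ennreal"
  assumes [measurable]: "f \<in> borel_measurable borel"
  shows "(\<integral>\<^sup>+x. f (c - x) \<partial>lborel) = (\<integral>\<^sup>+x. f x \<partial>lborel)"
  using nn_integral_real_affine[of f "-1" c] by simp

lemma borel_measurable_indicator_Icc [measurable (raw)]:
  fixes f g h :: "'a \<Rightarrow> real"
  assumes [measurable]: "f \<in> borel_measurable M" "g \<in> borel_measurable M" "h \<in> borel_measurable M"
  shows "(\<lambda>x. indicator {f x..g x} (h x) :: ennreal) \<in> borel_measurable M"
proof -
  have "(\<lambda>x. if f x \<le> h x \<and> h x \<le> g x then 1 else 0 :: ennreal) \<in> borel_measurable M"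
    by measurable
  then show ?thesis by (simp add: indicator_def of_bool_def)
qed

lemma nn_integral_atMost_finite:
  fixes g :: "real \<Rightarrow> real"
  assumes "\<And>t. t \<le> T \<Longrightarrow> g t \<le> B" "\<And>t. t < 0 \<Longrightarrow> g t = 0"
  shows "(\<integral>\<^sup>+t\<in>{..T}. ennreal (g t) \<partial>lborel) < \<infinity>"
proof -
  have "(\<integral>\<^sup>+t\<in>{..T}. ennreal (g t) \<partial>lborel) \<le> (\<integral>\<^sup>+t. ennreal B * indicator {0..T} t \<partial>lborel)"
  proof (intro nn_integral_mono)
    fix t show "ennreal (g t) * indicator {..T} t \<le> ennreal B * indicator {0..T} t"
      using assms(1)[of t] assms(2)[of t] by (cases "t < 0") (auto simp: indicator_def not_less intro!: ennreal_leI)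
  qed
  also have "\<dots> < \<infinity>"
    by (subst nn_integral_cmult_indicator) (auto simp: ennreal_mult_less_top emeasure_lborel_Icc_eq)
  finally show ?thesis .
qed

lemma nn_integral_power_exp:
  assumes "l > 0"
  shows "(\<integral>\<^sup>+s\<in>{0..}. ennreal (s ^ k * exp (- l * s)) \<partial>lborel) = ennreal (fact k / l ^ Suc k)"
proof -
  let ?I = "\<integral>\<^sup>+s\<in>{0..}. ennreal (s ^ k * exp (- l * s)) \<partial>lborel"
  have "ennreal (fact k) = (\<integral>\<^sup>+x. ennreal (x ^ k * exp (- x)) * indicator {0..} x \<partial>lborel)"
    using nn_intergal_power_times_exp_Ici[of k] by simp
  also have "\<dots> = ennreal l * (\<integral>\<^sup>+s. ennreal ((l * s) ^ k * exp (- (l * s))) * indicator {0..} (l * s) \<partial>lborel)"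
    using nn_integral_real_affine[of "\<lambda>x. ennreal (x ^ k * exp (- x)) * indicator {0..} x" l 0] assms by simp
  also have "(\<integral>\<^sup>+s. ennreal ((l * s) ^ k * exp (- (l * s))) * indicator {0..} (l * s) \<partial>lborel)
      = (\<integral>\<^sup>+s. ennreal (l ^ k) * (ennreal (s ^ k * exp (- l * s)) * indicator {0..} s) \<partial>lborel)"
    using assms by (intro nn_integral_cong)
      (auto simp: indicator_def power_mult_distrib ennreal_mult[symmetric] zero_le_mult_iff mult.assoc)
  also have "\<dots> = ennreal (l ^ k) * ?I"
    by (rule nn_integral_cmult) measurable
  finally have eq: "ennreal (fact k) = ennreal (l ^ Suc k) * ?I"
    using assms by (simp add: ennreal_mult mult.assoc)
  have "?I = ennreal (1 / l ^ Suc k) * (ennreal (l ^ Suc k) * ?I)"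
    using assms by (simp add: mult.assoc[symmetric] ennreal_mult[symmetric] del: power_Suc)
  also have "\<dots> = ennreal (fact k / l ^ Suc k)"
    unfolding eq[symmetric] using assms by (simp add: ennreal_mult[symmetric] del: power_Suc)
  finally show ?thesis .
qed

lemma
  assumes "\<gamma> > 0"
  shows inverse_ennreal_less_iff: "1 / G < ennreal \<gamma> \<longleftrightarrow> ennreal (1 / \<gamma>) < G"
    and eq_inverse_ennreal_iff: "ennreal \<gamma> = 1 / G \<longleftrightarrow> G = ennreal (1 / \<gamma>)"
proof -
  have "(1 / G < ennreal \<gamma> \<longleftrightarrow> ennreal (1 / \<gamma>) < G) \<and> (ennreal \<gamma> = 1 / G \<longleftrightarrow> G = ennreal (1 / \<gamma>))"
  proof (cases G)
    case (real r)
    show ?thesis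
    proof (cases "r = 0")
      case True
      then show ?thesis using assms real by (simp add: divide_ennreal_def)
    next
      case False
      then have "1 / G = ennreal (1 / r)" using real by (subst ennreal_1[symmetric], subst real(2), subst divide_ennreal) auto
      then show ?thesis using assms real False
        by (auto simp: ennreal_less_iff field_simps)
    qed
  next
    case top
    then show ?thesis using assms by simp
  qed
  then show "1 / G < ennreal \<gamma> \<longleftrightarrow> ennreal (1 / \<gamma>) < G" "ennreal \<gamma> = 1 / G \<longleftrightarrow> G = ennreal (1 / \<gamma>)" by auto
qed

text \<open>
  Tonelli's theorem, followed by a translation of the inner variable.
\<close>

lemma nn_integral_convolution_atMost:
  fixes f g :: "real \<Rightarrow> ennreal"
  assumes [measurable]: "f \<in> borel_measurable borel" "g \<in> borel_measurable borel"
  shows "(\<integral>\<^sup>+t\<in>{..T}. (\<integral>\<^sup>+s. f s * g (t - s) \<partial>lborel) \<partial>lborel) =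
         (\<integral>\<^sup>+u. g u * (\<integral>\<^sup>+s\<in>{..T - u}. f s \<partial>lborel) \<partial>lborel)"
proof -
  have "(\<integral>\<^sup>+t\<in>{..T}. (\<integral>\<^sup>+s. f s * g (t - s) \<partial>lborel) \<partial>lborel) =
        (\<integral>\<^sup>+t. (\<integral>\<^sup>+s. f s * (g (t - s) * indicator {..T} t) \<partial>lborel) \<partial>lborel)"
    by (subst nn_integral_multc[symmetric]) (auto simp: mult.assoc)
  also have "\<dots> = (\<integral>\<^sup>+s. (\<integral>\<^sup>+t. f s * (g (t - s) * indicator {..T} t) \<partial>lborel) \<partial>lborel)"
    by (rule lborel_pair.Fubini') simp
  also have "\<dots> = (\<integral>\<^sup>+s. (\<integral>\<^sup>+u. f s * (g u * indicator {..T - u} s) \<partial>lborel) \<partial>lborel)"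
  proof (rule nn_integral_cong)
    fix s :: real
    have "(\<integral>\<^sup>+t. f s * (g (t - s) * indicator {..T} t) \<partial>lborel) =
          (\<integral>\<^sup>+u. f s * (g (u + s - s) * indicator {..T} (u + s)) \<partial>lborel)"
      by (rule nn_integral_lborel_translate[symmetric]) simp
    also have "\<dots> = (\<integral>\<^sup>+u. f s * (g u * indicator {..T - u} s) \<partial>lborel)"
      by (intro nn_integral_cong) (auto simp: indicator_def)
    finally show "(\<integral>\<^sup>+t. f s * (g (t - s) * indicator {..T} t) \<partial>lborel) =
          (\<integral>\<^sup>+u. f s * (g u * indicator {..T - u} s) \<partial>lborel)" .
  qed
  also have "\<dots> = (\<integral>\<^sup>+u. (\<integral>\<^sup>+s. f s * (g u * indicator {..T - u} s) \<partial>lborel) \<partial>lborel)"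
  proof (rule lborel_pair.Fubini')
    have "(\<lambda>(y, x). f x * (g y * indicator {z. snd z \<le> T - fst z} (y, x)))
        \<in> borel_measurable (lborel \<Otimes>\<^sub>M lborel)"
      by measurable
    then show "(\<lambda>(y, x). f x * (g y * indicator {..T - y} x)) \<in> borel_measurable (lborel \<Otimes>\<^sub>M lborel)"
      by (simp add: indicator_def)
  qed
  also have "\<dots> = (\<integral>\<^sup>+u. g u * (\<integral>\<^sup>+s\<in>{..T - u}. f s \<partial>lborel) \<partial>lborel)"
    by (intro nn_integral_cong, subst nn_integral_cmult[symmetric]) (auto simp: ac_simps)
  finally show ?thesis .
qed

section \<open>Functions with vanishing increments\<close>

lemma tendsto_at_top_shift:
  fixes k :: "real \<Rightarrow> real"
  assumes "(k \<longlongrightarrow> l) at_top"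
  shows "((\<lambda>t. k (t + c)) \<longlongrightarrow> l) at_top"
proof (rule filterlim_compose[OF assms])
  show "filterlim (\<lambda>t. t + c) at_top at_top"
    using filterlim_tendsto_add_at_top[OF tendsto_const[of c] filterlim_ident] by (simp add: add.commute)
qed

text \<open>
  A value of size \<open>e\<close> forces size at least \<open>e / 2\<close> on an interval whose length depends only on
  \<open>e\<close> and \<open>K\<close>, hence a fixed amount of mass of the square; but the mass near infinity vanishes.
\<close>

lemma square_integrable_lipschitz_tendsto_zero:
  fixes g :: "real \<Rightarrow> real"
  assumes [measurable]: "g \<in> borel_measurable borel"
    and fin: "(\<integral>\<^sup>+t. ennreal ((g t)\<^sup>2) \<partial>lborel) < \<infinity>"
    and lip: "\<And>x y. a \<le> x \<Longrightarrow> x \<le> y \<Longrightarrow> \<bar>g y - g x\<bar> \<le> K * (y - x)"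
  shows "(g \<longlongrightarrow> 0) at_top"
proof (rule tendstoI)
  fix e :: real assume e: "e > 0"
  define d where "d = e / (\<bar>K\<bar> + 1) / 2"
  have d: "d > 0" "K * d \<le> e / 2"
  proof -
    show "d > 0" using e unfolding d_def by simp
    have "K * d \<le> (\<bar>K\<bar> + 1) * d" using \<open>d > 0\<close> by (intro mult_right_mono) auto
    also have "\<dots> = e / 2" unfolding d_def by (simp add: field_simps)
    finally show "K * d \<le> e / 2" .
  qed
  have int: "integrable lborel (\<lambda>t. (g t)\<^sup>2)"
    using fin by (intro integrableI_bounded) auto
  define I where "I = (\<lambda>y. \<integral>x. indicator {..y} x *\<^sub>R (g x)\<^sup>2 \<partial>lborel)"
  have I: "(I \<longlongrightarrow> (\<integral>x. (g x)\<^sup>2 \<partial>lborel)) at_top"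
    unfolding I_def by (rule tendsto_integral_at_top) (use int in auto)
  have "((\<lambda>t. I (t + d)) \<longlongrightarrow> (\<integral>x. (g x)\<^sup>2 \<partial>lborel)) at_top"
    by (rule tendsto_at_top_shift[OF I])
  from tendsto_diff[OF this I] have "((\<lambda>t. I (t + d) - I t) \<longlongrightarrow> 0) at_top"
    by simp
  then have "eventually (\<lambda>t. I (t + d) - I t < d * (e / 2)\<^sup>2) at_top"
    using d e by (intro order_tendstoD) auto
  then show "eventually (\<lambda>t. dist (g t) 0 < e) at_top"
    using eventually_ge_at_top[of a]
  proof eventually_elim
    case (elim t)
    show ?case
    proof (rule ccontr)
      assume "\<not> ?thesis"
      then have ge: "\<bar>g t\<bar> \<ge> e" by simp
      have low: "(e / 2)\<^sup>2 \<le> (g x)\<^sup>2" if "x \<in> {t<..t + d}" for x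
      proof -
        have "\<bar>g x - g t\<bar> \<le> K * (x - t)" using that elim by (intro lip) auto
        also have "\<dots> \<le> \<bar>K\<bar> * (x - t)" using that by (intro mult_right_mono) auto
        also have "\<dots> \<le> (\<bar>K\<bar> + 1) * d" using that by (intro mult_mono) auto
        also have "\<dots> = e / 2" unfolding d_def by (simp add: field_simps)
        finally have "\<bar>g x\<bar> \<ge> e / 2" using ge by linarith
        then show ?thesis using e by (subst abs_le_square_iff[symmetric]) auto
      qed
      have "d * (e / 2)\<^sup>2 = (\<integral>x. indicator {t<..t + d} x *\<^sub>R (e / 2)\<^sup>2 \<partial>lborel)"
        using d by simp
      also have "\<dots> \<le> (\<integral>x. indicator {t<..t + d} x *\<^sub>R (g x)\<^sup>2 \<partial>lborel)"
      proof (rule integral_mono)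
        show "integrable lborel (\<lambda>x. indicator {t<..t + d} x *\<^sub>R (e / 2)\<^sup>2)"
          using d by (intro integrable_scaleR_left integrable_real_indicator) auto
        show "integrable lborel (\<lambda>x. indicator {t<..t + d} x *\<^sub>R (g x)\<^sup>2)"
          by (intro integrable_mult_indicator int) auto
      qed (use low in \<open>auto simp: indicator_def\<close>)
      also have "\<dots> = I (t + d) - I t"
        unfolding I_def using int d
      proof (subst Bochner_Integration.integral_diff[symmetric])
        show "integrable lborel (\<lambda>x. indicator {..u} x *\<^sub>R (g x)\<^sup>2)"
             "integrable lborel (\<lambda>x. indicator {..u} x *\<^sub>R (g x)\<^sup>2)" for u
          by (intro integrable_mult_indicator int; simp)+
      qed (use d in \<open>auto intro!: Bochner_Integration.integral_cong simp: indicator_def\<close>)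
      finally show False using elim by simp
    qed
  qed
qed

text \<open>
  The shifts \<open>d\<close> with vanishing increments form an additive group.  An uncountable set of reals
  has two distinct members in a common cell of any grid, so the group has arbitrarily small positive
  elements, and every real number is close to one of their multiples.  The Lipschitz bound pays for
  the remaining distance.
\<close>

lemma lipschitz_increments_tendsto_zero:
  fixes h :: "real \<Rightarrow> real"
  assumes lip: "\<And>x y. 0 \<le> x \<Longrightarrow> x \<le> y \<Longrightarrow> \<bar>h y - h x\<bar> \<le> K * (y - x)"
    and unc: "uncountable {d. ((\<lambda>t. h (t + d) - h t) \<longlongrightarrow> 0) at_top}"
  shows "((\<lambda>t. h (t + d) - h t) \<longlongrightarrow> 0) at_top"
proof -
  define D where "D = {d. ((\<lambda>t. h (t + d) - h t) \<longlongrightarrow> 0) at_top}"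
  have D_minus: "-d \<in> D" if "d \<in> D" for d
  proof -
    have "((\<lambda>t. - (h (t + (-d) + d) - h (t + (-d)))) \<longlongrightarrow> - 0) at_top"
      using that tendsto_at_top_shift[of "\<lambda>t. h (t + d) - h t" 0 "-d"] unfolding D_def mem_Collect_eq
      by (intro tendsto_minus) simp
    then show ?thesis by (simp add: D_def)
  qed
  have D_add: "c + d \<in> D" if "c \<in> D" "d \<in> D" for c d
  proof -
    have "((\<lambda>t. (h (t + c + d) - h (t + c)) + (h (t + c) - h t)) \<longlongrightarrow> 0 + 0) at_top"
      using that tendsto_at_top_shift[of "\<lambda>t. h (t + d) - h t" 0 c] unfolding D_def mem_Collect_eq
      by (intro tendsto_add) auto
    then show ?thesis by (simp add: D_def add.assoc)
  qed
  have D_0: "0 \<in> D" by (simp add: D_def)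
  have D_nat: "real n * d \<in> D" if "d \<in> D" for n d
    by (induction n) (use D_0 D_add that in \<open>auto simp: algebra_simps\<close>)
  have D_int: "of_int n * d \<in> D" if "d \<in> D" for n d
  proof (cases "n \<ge> 0")
    case True then show ?thesis using D_nat[OF that, of "nat n"] by simp
  next
    case False then show ?thesis using D_minus[OF D_nat[OF that, of "nat (-n)"]] by simp
  qed
  have small: "\<exists>d\<in>D. 0 < d \<and> d < e" if e: "e > 0" for e
  proof -
    have "\<not> inj_on (\<lambda>d. \<lfloor>d / e\<rfloor>) D"
    proof
      assume "inj_on (\<lambda>d. \<lfloor>d / e\<rfloor>) D"
      then have "countable D" by (rule countable_image_inj_on[rotated]) auto
      then show False using unc by (simp add: D_def)
    qed
    then obtain x y where xy: "x \<in> D" "y \<in> D" "x \<noteq> y" "\<lfloor>x / e\<rfloor> = \<lfloor>y / e\<rfloor>"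
      by (auto simp: inj_on_def)
    have "\<bar>x / e - y / e\<bar> < 1" using xy(4) by linarith
    then have "\<bar>x - y\<bar> < e" using e by (simp add: diff_divide_distrib[symmetric] pos_divide_less_eq)
    moreover have "x - y \<in> D" "y - x \<in> D" using D_add[OF _ D_minus] xy(1,2) by fastforce+
    ultimately show ?thesis using xy(3) by (cases "x < y") (auto intro: bexI[of _ "x - y"] bexI[of _ "y - x"])
  qed
  have K: "K \<ge> 0" using lip[of 0 1] by auto
  show ?thesis
  proof (rule tendstoI)
    fix e :: real assume e: "e > 0"
    obtain c where c: "c \<in> D" "0 < c" "c < e / (2 * (K + 1))"
      using small[of "e / (2 * (K + 1))"] e K by auto
    define c' where "c' = of_int \<lfloor>d / c\<rfloor> * c"
    have "c' \<in> D" unfolding c'_def by (rule D_int) fact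
    have "of_int \<lfloor>d / c\<rfloor> \<le> d / c" "d / c < of_int \<lfloor>d / c\<rfloor> + 1" by linarith+
    then have c': "c' \<le> d" "d < c' + c" unfolding c'_def
      unfolding pos_le_divide_eq[OF c(2)] pos_divide_less_eq[OF c(2)]
      by (simp_all only: distrib_right mult_1)
    have "K * (d - c') \<le> (K + 1) * c" using c' K c by (intro mult_mono) auto
    also have "\<dots> < e / 2" using c K by (simp add: field_simps)
    finally have Kc: "K * (d - c') < e / 2" .
    have "eventually (\<lambda>t. dist (h (t + c') - h t) 0 < e / 2) at_top"
      using \<open>c' \<in> D\<close> e unfolding D_def mem_Collect_eq by (intro tendstoD) auto
    then show "eventually (\<lambda>t. dist (h (t + d) - h t) 0 < e) at_top"
      using eventually_ge_at_top[of "- c'"]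
    proof eventually_elim
      case (elim t)
      have "\<bar>h (t + d) - h (t + c')\<bar> \<le> K * (t + d - (t + c'))"
        using elim c' by (intro lip) auto
      then have "\<bar>h (t + d) - h (t + c')\<bar> < e / 2" using Kc by simp
      moreover have "\<bar>h (t + c') - h t\<bar> < e / 2" using elim by (simp add: dist_real_def)
      ultimately show ?case unfolding dist_real_def by linarith
    qed
  qed
qed

section \<open>The renewal equation\<close>

text \<open>
  All functions live on the whole line and vanish on the negative half-line, so that convolutions
  need no bounds of integration.  The equation is stated with the nonnegative integral, which makes
  the integrability of \<open>\<lambda>s. f s * h (t - s)\<close> a consequence instead of an assumption.
\<close>

locale renewal_equation =
  fixes f z h :: "real \<Rightarrow> real"
  assumes f_measurable [measurable]: "f \<in> borel_measurable borel"
    and z_measurable [measurable]: "z \<in> borel_measurable borel"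
    and h_measurable [measurable]: "h \<in> borel_measurable borel"
    and f_nonneg: "\<And>t. 0 \<le> f t"
    and z_nonneg: "\<And>t. 0 \<le> z t"
    and h_nonneg: "\<And>t. 0 \<le> h t"
    and f_neg: "\<And>t. t < 0 \<Longrightarrow> f t = 0"
    and z_neg: "\<And>t. t < 0 \<Longrightarrow> z t = 0"
    and h_neg: "\<And>t. t < 0 \<Longrightarrow> h t = 0"
    and f_density: "(\<integral>\<^sup>+s. ennreal (f s) \<partial>lborel) = 1"
    and h_locally_bounded: "\<And>T. \<exists>B. \<forall>t\<le>T. h t \<le> B"
    and renewal: "\<And>t. 0 \<le> t \<Longrightarrow>
      ennreal (h t) = ennreal (z t) + (\<integral>\<^sup>+s. ennreal (f s * h (t - s)) \<partial>lborel)"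
begin

definition tail :: "real \<Rightarrow> real" where
  "tail x = (LINT s:{x<..}|lborel. f s)"

text \<open>
  The expectation of the minimum of \<open>t\<close> and a random variable with density \<open>f\<close>.
\<close>

definition truncated_mean :: "real \<Rightarrow> real" where
  "truncated_mean t = (LINT s:{0..t}|lborel. tail s)"

definition mean :: ennreal where
  "mean = (\<integral>\<^sup>+s. ennreal (s * f s) \<partial>lborel)"

lemma f_integrable: "integrable lborel f"
  using f_density by (intro integrableI_nonneg) (auto simp: f_nonneg)

lemma ennreal_tail: "ennreal (tail x) = (\<integral>\<^sup>+s\<in>{x<..}. ennreal (f s) \<partial>lborel)"
proof -
  have "integrable lborel (\<lambda>s. indicator {x<..} s *\<^sub>R f s)"
    by (intro integrable_mult_indicator f_integrable) auto
  then have "(\<integral>\<^sup>+s. ennreal (indicator {x<..} s *\<^sub>R f s) \<partial>lborel) = ennreal (tail x)"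
    unfolding tail_def set_lebesgue_integral_def
    by (intro nn_integral_eq_integral) (auto simp: f_nonneg)
  moreover have "(\<integral>\<^sup>+s. ennreal (indicator {x<..} s *\<^sub>R f s) \<partial>lborel)
      = (\<integral>\<^sup>+s\<in>{x<..}. ennreal (f s) \<partial>lborel)"
    by (intro nn_integral_cong) (auto simp: indicator_def)
  ultimately show ?thesis by simp
qed

lemma tail_nonneg: "0 \<le> tail x"
  unfolding tail_def set_lebesgue_integral_def by (intro integral_nonneg_AE) (auto simp: f_nonneg)

lemma cdf_add_tail:
  "(\<integral>\<^sup>+s\<in>{..x}. ennreal (f s) \<partial>lborel) + ennreal (tail x) = 1"
proof -
  have "(\<integral>\<^sup>+s\<in>{..x}. ennreal (f s) \<partial>lborel) + ennreal (tail x) = (\<integral>\<^sup>+s. ennreal (f s) \<partial>lborel)"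
    unfolding ennreal_tail
    by (subst nn_integral_add[symmetric]) (auto intro!: nn_integral_cong simp: indicator_def)
  then show ?thesis using f_density by simp
qed

lemma tail_le_1: "tail x \<le> 1"
proof -
  have "ennreal (tail x) \<le> 1" unfolding cdf_add_tail[of x, symmetric] by simp
  then show ?thesis by simp
qed

lemma antimono_tail: "x \<le> y \<Longrightarrow> tail y \<le> tail x"
proof -
  assume "x \<le> y"
  then have "ennreal (tail y) \<le> ennreal (tail x)"
    unfolding ennreal_tail by (intro nn_integral_mono) (auto simp: indicator_def)
  then show ?thesis by (simp add: tail_nonneg)
qed

lemma tail_measurable [measurable]: "tail \<in> borel_measurable borel"
proof -
  have "(\<lambda>x. - tail x) \<in> borel_measurable borel"
    by (intro borel_measurable_mono monoI) (simp add: antimono_tail)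
  then have "(\<lambda>x. - (- tail x)) \<in> borel_measurable borel" by (rule borel_measurable_uminus)
  then show ?thesis by simp
qed

lemma renewal_all:
  "ennreal (h t) = ennreal (z t) + (\<integral>\<^sup>+s. ennreal (f s * h (t - s)) \<partial>lborel)"
proof (cases "t < 0")
  case True
  have *: "f s * h (t - s) = 0" for s
    using True f_neg[of s] h_neg[of "t - s"] by (cases "s < 0") auto
  show ?thesis using True by (simp add: z_neg h_neg * del: mult_eq_0_iff)
qed (use renewal in simp)

text \<open>
  Of the mass that \<open>g\<close> puts at \<open>u\<close>, convolution with \<open>f\<close> moves the fraction \<open>tail (T - u)\<close> beyond \<open>T\<close>
  and keeps the rest below.
\<close>

lemma nn_integral_convolution_density:
  assumes [measurable]: "g \<in> borel_measurable borel" and nonneg: "\<And>t. 0 \<le> (g t :: real)"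
  shows "(\<integral>\<^sup>+t\<in>{..T}. (\<integral>\<^sup>+s. ennreal (f s * g (t - s)) \<partial>lborel) \<partial>lborel)
       + (\<integral>\<^sup>+u\<in>{..T}. ennreal (g u * tail (T - u)) \<partial>lborel) = (\<integral>\<^sup>+u\<in>{..T}. ennreal (g u) \<partial>lborel)"
proof -
  have "(\<integral>\<^sup>+t\<in>{..T}. (\<integral>\<^sup>+s. ennreal (f s * g (t - s)) \<partial>lborel) \<partial>lborel)
      = (\<integral>\<^sup>+u. ennreal (g u) * (\<integral>\<^sup>+s\<in>{..T - u}. ennreal (f s) \<partial>lborel) \<partial>lborel)"
    unfolding ennreal_mult[OF f_nonneg nonneg] by (rule nn_integral_convolution_atMost) measurable
  also have "\<dots> = (\<integral>\<^sup>+u\<in>{..T}. ennreal (g u) * (\<integral>\<^sup>+s\<in>{..T - u}. ennreal (f s) \<partial>lborel) \<partial>lborel)"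
  proof (intro nn_integral_cong)
    fix u :: real
    have "(\<integral>\<^sup>+s\<in>{..T - u}. ennreal (f s) \<partial>lborel) = (\<integral>\<^sup>+(s::real). 0 \<partial>lborel)" if "u > T"
      using that by (intro nn_integral_cong) (auto simp: indicator_def f_neg)
    then show "ennreal (g u) * (\<integral>\<^sup>+s\<in>{..T - u}. ennreal (f s) \<partial>lborel) =
      ennreal (g u) * (\<integral>\<^sup>+s\<in>{..T - u}. ennreal (f s) \<partial>lborel) * indicator {..T} u"
      by (cases "u \<le> T") auto
  qed
  finally have "(\<integral>\<^sup>+t\<in>{..T}. (\<integral>\<^sup>+s. ennreal (f s * g (t - s)) \<partial>lborel) \<partial>lborel)
       + (\<integral>\<^sup>+u\<in>{..T}. ennreal (g u * tail (T - u)) \<partial>lborel) =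
      (\<integral>\<^sup>+u\<in>{..T}. ennreal (g u) * (\<integral>\<^sup>+s\<in>{..T - u}. ennreal (f s) \<partial>lborel) \<partial>lborel)
       + (\<integral>\<^sup>+u\<in>{..T}. ennreal (g u * tail (T - u)) \<partial>lborel)"
    by (rule arg_cong)
  also have "\<dots>
     = (\<integral>\<^sup>+u\<in>{..T}. ennreal (g u) * ((\<integral>\<^sup>+s\<in>{..T - u}. ennreal (f s) \<partial>lborel) + ennreal (tail (T - u))) \<partial>lborel)"
  proof (subst nn_integral_add[symmetric])
    have "(\<lambda>u. 1 - ennreal (tail (T - u))) \<in> borel_measurable borel" by measurable
    moreover have "1 - ennreal (tail (T - u)) = (\<integral>\<^sup>+s\<in>{..T - u}. ennreal (f s) \<partial>lborel)" for u
      unfolding cdf_add_tail[of "T - u", symmetric] by simp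
    ultimately have [measurable]: "(\<lambda>u. (\<integral>\<^sup>+s\<in>{..T - u}. ennreal (f s) \<partial>lborel)) \<in> borel_measurable borel"
      by simp
    show "(\<lambda>u. ennreal (g u) * (\<integral>\<^sup>+s\<in>{..T - u}. ennreal (f s) \<partial>lborel) * indicator {..T} u) \<in> borel_measurable lborel"
      by measurable
    show "(\<lambda>u. ennreal (g u * tail (T - u)) * indicator {..T} u) \<in> borel_measurable lborel"
      by measurable
    show "(\<integral>\<^sup>+u. ennreal (g u) * (\<integral>\<^sup>+s\<in>{..T - u}. ennreal (f s) \<partial>lborel) * indicator {..T} u
        + ennreal (g u * tail (T - u)) * indicator {..T} u \<partial>lborel) =
      (\<integral>\<^sup>+u\<in>{..T}. ennreal (g u) * ((\<integral>\<^sup>+s\<in>{..T - u}. ennreal (f s) \<partial>lborel) + ennreal (tail (T - u))) \<partial>lborel)"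
      by (intro nn_integral_cong) (simp only: ennreal_mult nonneg tail_nonneg distrib_left distrib_right)
  qed
  also have "\<dots> = (\<integral>\<^sup>+u\<in>{..T}. ennreal (g u) \<partial>lborel)"
    unfolding cdf_add_tail mult_1_right ..
  finally show ?thesis .
qed

text \<open>
  Integrate the renewal equation up to \<open>T\<close>, and cancel the mass of the convolution, which is finite
  by local boundedness.
\<close>

lemma conservation_nn:
  "(\<integral>\<^sup>+u\<in>{..T}. ennreal (h u * tail (T - u)) \<partial>lborel) = (\<integral>\<^sup>+u\<in>{..T}. ennreal (z u) \<partial>lborel)"
proof -
  obtain B where B: "\<And>t. t \<le> T \<Longrightarrow> h t \<le> B" using h_locally_bounded by blast
  let ?c = "\<integral>\<^sup>+t\<in>{..T}. (\<integral>\<^sup>+s. ennreal (f s * h (t - s)) \<partial>lborel) \<partial>lborel"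
  have sum: "?c + (\<integral>\<^sup>+u\<in>{..T}. ennreal (h u * tail (T - u)) \<partial>lborel) = (\<integral>\<^sup>+u\<in>{..T}. ennreal (h u) \<partial>lborel)"
    by (rule nn_integral_convolution_density) (auto simp: h_nonneg)
  also have "\<dots> = ?c + (\<integral>\<^sup>+u\<in>{..T}. ennreal (z u) \<partial>lborel)"
    by (subst nn_integral_add[symmetric], measurable)
       (auto intro!: nn_integral_cong simp: indicator_def add.commute renewal_all[symmetric])
  finally have eq: "?c + (\<integral>\<^sup>+u\<in>{..T}. ennreal (h u * tail (T - u)) \<partial>lborel)
      = ?c + (\<integral>\<^sup>+u\<in>{..T}. ennreal (z u) \<partial>lborel)" .
  have "(\<integral>\<^sup>+u\<in>{..T}. ennreal (h u) \<partial>lborel) < \<infinity>"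
    by (rule nn_integral_atMost_finite[where B=B]) (use B h_neg in auto)
  then have "?c < \<infinity>"
    using sum[symmetric] by (simp add: ennreal_add_eq_top less_top)
  with eq show ?thesis by (auto simp: ennreal_add_left_cancel)
qed

lemma z_integrable_atMost: "integrable lborel (\<lambda>u. indicator {..T} u *\<^sub>R z u)"
proof (intro integrableI_nonneg)
  obtain B where B: "\<And>t. t \<le> T \<Longrightarrow> h t \<le> B" using h_locally_bounded by blast
  have "z t \<le> h t" for t
  proof -
    have "ennreal (z t) \<le> ennreal (h t)" unfolding renewal_all[of t] by simp
    then show ?thesis by (simp add: h_nonneg)
  qed
  then have "(\<integral>\<^sup>+t\<in>{..T}. ennreal (z t) \<partial>lborel) < \<infinity>"
    using B z_neg by (intro nn_integral_atMost_finite[where B=B]) (blast intro: order_trans)+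
  moreover have "(\<integral>\<^sup>+t. ennreal (indicator {..T} t *\<^sub>R z t) \<partial>lborel) = (\<integral>\<^sup>+t\<in>{..T}. ennreal (z t) \<partial>lborel)"
    by (intro nn_integral_cong) (auto simp: indicator_def)
  ultimately show "(\<integral>\<^sup>+t. ennreal (indicator {..T} t *\<^sub>R z t) \<partial>lborel) < \<infinity>" by simp
qed (auto simp: z_nonneg)

lemma conservation:
  shows "integrable lborel (\<lambda>s. indicator {0..} s *\<^sub>R (tail s * h (T - s)))" (is "integrable _ ?g")
    and "(\<integral>s. indicator {0..} s *\<^sub>R (tail s * h (T - s)) \<partial>lborel) = (\<integral>u. indicator {..T} u *\<^sub>R z u \<partial>lborel)"
proof -
  have "(\<integral>\<^sup>+s. ennreal (?g s) \<partial>lborel) = (\<integral>\<^sup>+s. ennreal (?g (T - s)) \<partial>lborel)"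
    by (rule nn_integral_lborel_reflect[symmetric]) measurable
  also have "\<dots> = (\<integral>\<^sup>+u\<in>{..T}. ennreal (h u * tail (T - u)) \<partial>lborel)"
    by (intro nn_integral_cong) (auto simp: indicator_def mult.commute)
  also have "\<dots> = (\<integral>\<^sup>+u\<in>{..T}. ennreal (z u) \<partial>lborel)"
    by (rule conservation_nn)
  also have "\<dots> = (\<integral>\<^sup>+t. ennreal (indicator {..T} t *\<^sub>R z t) \<partial>lborel)"
    by (intro nn_integral_cong) (auto simp: indicator_def)
  also have "\<dots> = ennreal (\<integral>u. indicator {..T} u *\<^sub>R z u \<partial>lborel)"
    using z_integrable_atMost by (intro nn_integral_eq_integral) (auto simp: z_nonneg)
  finally have *: "(\<integral>\<^sup>+s. ennreal (?g s) \<partial>lborel) = ennreal (\<integral>u. indicator {..T} u *\<^sub>R z u \<partial>lborel)" .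
  show "integrable lborel ?g"
    by (rule integrableI_nonneg) (use * in \<open>auto simp: h_nonneg tail_nonneg\<close>)
  show "integral\<^sup>L lborel ?g = (\<integral>u. indicator {..T} u *\<^sub>R z u \<partial>lborel)"
    by (subst integral_eq_nn_integral)
       (use * in \<open>auto simp: h_nonneg tail_nonneg z_nonneg intro!: integral_nonneg_AE\<close>)
qed

lemma truncated_tail_integrable: "integrable lborel (\<lambda>s. indicator {0..t} s *\<^sub>R tail s)"
proof (rule Bochner_Integration.integrable_bound[where f="\<lambda>s. indicator {0..t} s *\<^sub>R (1::real)"])
  show "integrable lborel (\<lambda>s. indicator {0..t} s *\<^sub>R (1::real))"
    by (intro integrable_scaleR_left integrable_real_indicator) (auto simp: emeasure_lborel_Icc_eq)
qed (auto simp: indicator_def tail_nonneg tail_le_1)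

text \<open>
  The layer-cake formula for the expectation of a nonnegative random variable.
\<close>

lemma nn_integral_tail: "(\<integral>\<^sup>+s\<in>{0..}. ennreal (tail s) \<partial>lborel) = mean"
proof -
  have "(\<integral>\<^sup>+s\<in>{0..}. ennreal (tail s) \<partial>lborel) =
        (\<integral>\<^sup>+s. (\<integral>\<^sup>+r. ennreal (f r) * (indicator {s<..} r * indicator {0..} s) \<partial>lborel) \<partial>lborel)"
    unfolding ennreal_tail by (subst nn_integral_multc[symmetric]) (auto simp: mult.assoc)
  also have "\<dots> = (\<integral>\<^sup>+r. (\<integral>\<^sup>+s. ennreal (f r) * (indicator {s<..} r * indicator {0..} s) \<partial>lborel) \<partial>lborel)"
  proof (rule lborel_pair.Fubini')
    have "(\<lambda>(r, s). ennreal (f r) * (indicator {z. snd z < fst z} (r, s) * indicator {0..} s))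
        \<in> borel_measurable (lborel \<Otimes>\<^sub>M lborel)"
      by measurable
    then show "(\<lambda>(r, s). ennreal (f r) * (indicator {s<..} r * indicator {0..} s))
        \<in> borel_measurable (lborel \<Otimes>\<^sub>M lborel)"
      by (simp add: indicator_def)
  qed
  also have "\<dots> = (\<integral>\<^sup>+r. ennreal (r * f r) \<partial>lborel)"
  proof (rule nn_integral_cong)
    fix r :: real
    show "(\<integral>\<^sup>+s. ennreal (f r) * (indicator {s<..} r * indicator {0..} s) \<partial>lborel) = ennreal (r * f r)"
    proof (cases "r < 0")
      case False
      have "(\<integral>\<^sup>+s. ennreal (f r) * (indicator {s<..} r * indicator {0..} s) \<partial>lborel)
          = (\<integral>\<^sup>+s. ennreal (f r) * indicator {0..<r} s \<partial>lborel)"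
        by (intro nn_integral_cong) (auto simp: indicator_def)
      also have "\<dots> = ennreal (r * f r)"
        using False by (subst nn_integral_cmult_indicator) (auto simp: ennreal_mult f_nonneg mult.commute)
      finally show ?thesis .
    qed (simp add: f_neg)
  qed
  finally show ?thesis by (simp add: mean_def)
qed

lemma tail_integrable:
  assumes "mean < \<infinity>"
  shows "integrable lborel (\<lambda>s. indicator {0..} s *\<^sub>R tail s)"
    and "(\<integral>s. indicator {0..} s *\<^sub>R tail s \<partial>lborel) = enn2real mean"
proof -
  have *: "(\<integral>\<^sup>+s. ennreal (indicator {0..} s *\<^sub>R tail s) \<partial>lborel) = mean"
    unfolding nn_integral_tail[symmetric] by (intro nn_integral_cong) (auto simp: indicator_def)
  show "integrable lborel (\<lambda>s. indicator {0..} s *\<^sub>R tail s)"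
    by (rule integrableI_nonneg) (use * assms in \<open>auto simp: tail_nonneg\<close>)
  show "(\<integral>s. indicator {0..} s *\<^sub>R tail s \<partial>lborel) = enn2real mean"
    by (subst integral_eq_nn_integral) (use * in \<open>auto simp: tail_nonneg\<close>)
qed

lemma mean_pos: "mean > 0"
proof (rule ccontr)
  assume "\<not> mean > 0"
  then have "mean = 0" by simp
  then have "AE s in lborel. ennreal (s * f s) = 0"
    unfolding mean_def by (subst (asm) nn_integral_0_iff_AE) auto
  moreover have "AE s in lborel. s \<noteq> (0::real)" by (rule AE_lborel_singleton)
  ultimately have "AE s in lborel. ennreal (f s) = 0"
    by eventually_elim (use f_neg in \<open>force simp: ennreal_eq_0_iff mult_le_0_iff not_less\<close>)
  then have "(\<integral>\<^sup>+s. ennreal (f s) \<partial>lborel) = (\<integral>\<^sup>+(s::real). 0 \<partial>lborel)" by (rule nn_integral_cong_AE)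
  then show False using f_density by simp
qed

lemma truncated_mean_tendsto:
  assumes "mean < \<infinity>"
  shows "(truncated_mean \<longlongrightarrow> enn2real mean) at_top"
proof -
  have "((\<lambda>t. \<integral>s. indicator {..t} s *\<^sub>R (indicator {0..} s *\<^sub>R tail s) \<partial>lborel) \<longlongrightarrow> enn2real mean) at_top"
    using tendsto_integral_at_top[OF _ tail_integrable(1)[OF assms]] tail_integrable(2)[OF assms] by simp
  moreover have "(\<integral>s. indicator {..t} s *\<^sub>R (indicator {0..} s *\<^sub>R tail s) \<partial>lborel) = truncated_mean t" for t
    unfolding truncated_mean_def set_lebesgue_integral_def
    by (intro Bochner_Integration.integral_cong) (auto simp: indicator_def)
  ultimately show ?thesis by simp
qed

text \<open>
  Since \<open>h\<close> is nondecreasing, the conservation law at time \<open>t\<close> is bounded above by replacing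
  \<open>h (t - s)\<close> with \<open>h t\<close>, and the one at time \<open>t + a\<close> is bounded below by restricting to \<open>s \<le> a\<close>
  and replacing \<open>h (t + a - s)\<close> with \<open>h t\<close>.
\<close>

lemma
  assumes z: "\<And>t. 0 \<le> t \<Longrightarrow> z t = 1"
    and mono: "\<And>s t. s \<le> t \<Longrightarrow> h s \<le> h t"
  shows le_renewal_times_truncated_mean: "0 \<le> t \<Longrightarrow> t \<le> h t * truncated_mean t"
    and renewal_times_truncated_mean_le: "0 \<le> t \<Longrightarrow> 0 \<le> a \<Longrightarrow> h t * truncated_mean a \<le> t + a"
proof -
  have z_int: "(\<integral>u. indicator {..T} u *\<^sub>R z u \<partial>lborel) = T" if "0 \<le> T" for T
  proof -
    have "(\<integral>u. indicator {..T} u *\<^sub>R z u \<partial>lborel) = (\<integral>u. indicator {0..T} u \<partial>lborel)"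
      by (intro Bochner_Integration.integral_cong) (auto simp: indicator_def z z_neg)
    then show ?thesis using that by simp
  qed
  have tm: "h t * truncated_mean a = (\<integral>s. h t * (indicator {0..a} s *\<^sub>R tail s) \<partial>lborel)" for t a
    unfolding truncated_mean_def set_lebesgue_integral_def by (rule integral_mult_right_zero[symmetric])
  show "t \<le> h t * truncated_mean t" if "0 \<le> t"
  proof -
    have "t = (\<integral>s. indicator {0..} s *\<^sub>R (tail s * h (t - s)) \<partial>lborel)"
      using conservation(2)[of t] z_int[OF that] by simp
    also have "\<dots> \<le> (\<integral>s. h t * (indicator {0..t} s *\<^sub>R tail s) \<partial>lborel)"
    proof (intro integral_mono conservation(1) integrable_mult_right truncated_tail_integrable)
      fix s show "indicator {0..} s *\<^sub>R (tail s * h (t - s)) \<le> h t * (indicator {0..t} s *\<^sub>R tail s)"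
        using mono[of "t - s" t] h_neg[of "t - s"] tail_nonneg[of s]
        by (cases "s \<le> t") (auto simp: indicator_def mult.commute[of "tail s"] intro!: mult_right_mono)
    qed
    finally show ?thesis by (simp add: tm)
  qed
  show "h t * truncated_mean a \<le> t + a" if "0 \<le> t" "0 \<le> a"
  proof -
    have "h t * truncated_mean a \<le> (\<integral>s. indicator {0..} s *\<^sub>R (tail s * h (t + a - s)) \<partial>lborel)"
      unfolding tm
    proof (intro integral_mono conservation(1) integrable_mult_right truncated_tail_integrable)
      fix s show "h t * (indicator {0..a} s *\<^sub>R tail s) \<le> indicator {0..} s *\<^sub>R (tail s * h (t + a - s))"
        using mono[of t "t + a - s"] tail_nonneg[of s] h_nonneg[of "t + a - s"]
        by (cases "s \<le> a") (auto simp: indicator_def mult.commute[of "tail s"] intro!: mult_right_mono)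
    qed
    also have "\<dots> = t + a" using conservation(2)[of "t + a"] z_int[of "t + a"] that by simp
    finally show ?thesis .
  qed
qed

text \<open>
  The two bounds on \<open>h t * truncated_mean a\<close> pinch \<open>h t / t\<close>, because the truncated mean increases
  to the mean.
\<close>

lemma elementary_renewal:
  assumes z: "\<And>t. 0 \<le> t \<Longrightarrow> z t = 1"
    and mono: "\<And>s t. s \<le> t \<Longrightarrow> h s \<le> h t"
    and fin: "mean < \<infinity>"
  shows "((\<lambda>t. h t / t) \<longlongrightarrow> 1 / enn2real mean) at_top"
proof -
  define m where "m = enn2real mean"
  have m: "m > 0" unfolding m_def using mean_pos fin by (simp add: enn2real_positive_iff)
  note lim = truncated_mean_tendsto[OF fin, folded m_def]
  have le_m: "truncated_mean t \<le> m" for t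
    unfolding m_def tail_integrable(2)[OF fin, symmetric] truncated_mean_def set_lebesgue_integral_def
    by (intro integral_mono truncated_tail_integrable tail_integrable fin)
       (auto simp: indicator_def tail_nonneg)
  show ?thesis unfolding m_def[symmetric]
  proof (rule order_tendstoI)
    fix x assume x: "x < 1 / m"
    show "eventually (\<lambda>t. x < h t / t) at_top"
      using eventually_gt_at_top[of 0]
    proof eventually_elim
      case (elim t)
      have "t \<le> h t * truncated_mean t" using elim by (intro le_renewal_times_truncated_mean z mono) auto
      also have "\<dots> \<le> h t * m" by (intro mult_left_mono le_m h_nonneg)
      finally have "1 / m \<le> h t / t" using m elim by (simp add: field_simps)
      then show ?case using x by simp
    qed
  next
    fix x assume x: "1 / m < x"
    then have "x > 0" using m by (meson less_trans zero_less_divide_1_iff)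
    then have "eventually (\<lambda>a. 1 / x < truncated_mean a) at_top"
      using x m by (intro order_tendstoD[OF lim]) (simp add: field_simps)
    then have "eventually (\<lambda>a. 0 \<le> a \<and> 1 / x < truncated_mean a) at_top"
      using eventually_ge_at_top[of 0] by eventually_elim auto
    \<comment> \<open>Freezing \<open>a\<close> while \<open>t\<close> grows makes the additive error \<open>a\<close> in the upper bound negligible.\<close>
    then obtain a where a: "0 \<le> a" "1 / x < truncated_mean a"
      using eventually_happens'[OF trivial_limit_at_top_linorder] by blast
    define b where "b = truncated_mean a"
    have b: "b > 0" "1 < x * b" using a \<open>x > 0\<close> unfolding b_def
      by (auto simp: field_simps intro: less_trans[of _ "1/x"])
    have "((\<lambda>t. (1 + a / t) / b) \<longlongrightarrow> (1 + 0) / b) at_top"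
      by (intro tendsto_intros real_tendsto_divide_at_top[OF tendsto_const filterlim_ident]) (use b in auto)
    then have "eventually (\<lambda>t. (1 + a / t) / b < x) at_top"
      using b by (intro order_tendstoD) (auto simp: field_simps)
    then show "eventually (\<lambda>t. h t / t < x) at_top"
      using eventually_gt_at_top[of 0]
    proof eventually_elim
      case (elim t)
      have "h t * b \<le> t + a" unfolding b_def
        using elim a by (intro renewal_times_truncated_mean_le z mono) auto
      then have "h t / t \<le> (1 + a / t) / b" using b elim by (simp add: field_simps)
      then show ?case using elim by simp
    qed
  qed
qed

text \<open>
  If \<open>h\<close> cannot drop quickly, a large value at \<open>t\<close> makes \<open>h\<close> large on \<open>[t, t + 1]\<close>; the
  conservation law at time \<open>t + 1\<close> forbids this, as its right-hand side stays below the integral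
  of \<open>z\<close>.  Positivity of \<open>z\<close> before time 1 guarantees that \<open>f\<close> leaves some tail mass on \<open>[0, 1]\<close>.
\<close>

lemma renewal_solution_bounded:
  assumes z: "integrable lborel z"
    and z_pos: "0 < (\<integral>u. indicator {..1} u *\<^sub>R z u \<partial>lborel)"
    and c: "0 \<le> c"
    and slow: "\<And>s d. 0 \<le> s \<Longrightarrow> 0 \<le> d \<Longrightarrow> exp (- c * d) * h s \<le> h (s + d)"
  obtains C where "\<And>t. h t \<le> C"
proof -
  obtain B where B: "\<And>t. t \<le> 1 \<Longrightarrow> h t \<le> B" using h_locally_bounded by blast
  have tm: "truncated_mean 1 > 0"
  proof (rule ccontr)
    assume "\<not> truncated_mean 1 > 0"
    have "0 < (\<integral>s. indicator {0..} s *\<^sub>R (tail s * h (1 - s)) \<partial>lborel)"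
      unfolding conservation(2) by (rule z_pos)
    also have "\<dots> \<le> (\<integral>s. B * (indicator {0..1} s *\<^sub>R tail s) \<partial>lborel)"
    proof (intro integral_mono conservation(1) integrable_mult_right truncated_tail_integrable)
      fix s show "indicator {0..} s *\<^sub>R (tail s * h (1 - s)) \<le> B * (indicator {0..1} s *\<^sub>R tail s)"
        using B[of "1 - s"] h_neg[of "1 - s"] tail_nonneg[of s]
        by (cases "s \<le> 1") (auto simp: indicator_def mult.commute[of "tail s"] intro!: mult_right_mono)
    qed
    also have "\<dots> = B * truncated_mean 1"
      unfolding truncated_mean_def set_lebesgue_integral_def by (rule integral_mult_right_zero)
    also have "\<dots> \<le> 0"
      using \<open>\<not> truncated_mean 1 > 0\<close> B[of 0] h_nonneg[of 0] by (intro mult_nonneg_nonpos) auto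
    finally show False by simp
  qed
  have "h t \<le> exp c * (\<integral>u. z u \<partial>lborel) / truncated_mean 1" for t
  proof (cases "0 \<le> t")
    case True
    have "exp (- c) * h t * truncated_mean 1 = (\<integral>s. exp (- c) * h t * (indicator {0..1} s *\<^sub>R tail s) \<partial>lborel)"
      unfolding truncated_mean_def set_lebesgue_integral_def by (rule integral_mult_right_zero[symmetric])
    also have "\<dots> \<le> (\<integral>s. indicator {0..} s *\<^sub>R (tail s * h (t + 1 - s)) \<partial>lborel)"
    proof (intro integral_mono conservation(1) integrable_mult_right truncated_tail_integrable)
      fix s show "exp (- c) * h t * (indicator {0..1} s *\<^sub>R tail s) \<le> indicator {0..} s *\<^sub>R (tail s * h (t + 1 - s))"
      proof (cases "s \<in> {0..1}")
        case True
        have "exp (- c) * h t \<le> exp (- c * (1 - s)) * h t"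
          using True c h_nonneg by (intro mult_right_mono) (auto simp: mult_left_le)
        also have "\<dots> \<le> h (t + 1 - s)" using slow[of t "1 - s"] True \<open>0 \<le> t\<close> by (simp add: algebra_simps)
        finally show ?thesis using True tail_nonneg[of s]
          by (simp add: mult.commute[of "tail s"] mult_right_mono)
      qed (auto simp: indicator_def tail_nonneg h_nonneg)
    qed
    also have "\<dots> = (\<integral>u. indicator {..t + 1} u *\<^sub>R z u \<partial>lborel)" by (rule conservation(2))
    also have "\<dots> \<le> (\<integral>u. z u \<partial>lborel)"
      by (intro integral_mono z_integrable_atMost z) (auto simp: indicator_def z_nonneg)
    finally have "exp c * (exp (- c) * h t * truncated_mean 1) \<le> exp c * (\<integral>u. z u \<partial>lborel)"
      by (rule mult_left_mono) simp
    then have "h t * truncated_mean 1 \<le> exp c * (\<integral>u. z u \<partial>lborel)"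
      by (simp add: mult.assoc[symmetric] exp_add[symmetric])
    then show ?thesis unfolding pos_le_divide_eq[OF tm] .
  next
    case False
    then show ?thesis using tm by (simp add: h_neg z_nonneg integral_nonneg_AE)
  qed
  then show thesis using that by blast
qed

text \<open>
  Expanding the square produces \<open>f * h\<^sup>2\<close>, the cross term \<open>- 2 h t (f * h) t\<close> with
  \<open>f * h = h - z\<close>, and \<open>(h t)\<^sup>2\<close> because \<open>f\<close> has total mass 1.  Moving the terms so that both sides
  are sums of nonnegative ones allows integration in \<open>t\<close> without further integrability conditions.
\<close>

lemma quadratic_identity:
  "(\<integral>\<^sup>+s. ennreal (f s * (h (t - s) - h t)\<^sup>2) \<partial>lborel) + ennreal ((h t)\<^sup>2)
    = (\<integral>\<^sup>+s. ennreal (f s * (h (t - s))\<^sup>2) \<partial>lborel) + ennreal (2 * h t * z t)"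
proof -
  obtain B where B: "\<And>u. u \<le> t \<Longrightarrow> h u \<le> B" using h_locally_bounded by blast
  have bdd: "integrable lborel (\<lambda>s. f s * k (t - s))"
    if [measurable]: "k \<in> borel_measurable borel" and k: "\<And>u. u \<le> t \<Longrightarrow> \<bar>k u\<bar> \<le> C" for k and C :: real
  proof (rule Bochner_Integration.integrable_bound[where f="\<lambda>s. C * f s"])
    show "integrable lborel (\<lambda>s. C * f s)" by (intro integrable_mult_right f_integrable)
    have "norm (f s * k (t - s)) \<le> norm (C * f s)" for s
    proof (cases "s < 0")
      case False
      have "\<bar>f s\<bar> * \<bar>k (t - s)\<bar> \<le> \<bar>f s\<bar> * \<bar>C\<bar>" using k[of "t - s"] False by (intro mult_left_mono) auto
      then show ?thesis by (simp add: abs_mult mult.commute)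
    qed (simp add: f_neg)
    then show "AE s in lborel. norm (f s * k (t - s)) \<le> norm (C * f s)" by simp
  qed measurable
  have i1: "integrable lborel (\<lambda>s. f s * h (t - s))"
    by (rule bdd[where C=B]) (use B h_nonneg in auto)
  have i2: "integrable lborel (\<lambda>s. f s * (h (t - s))\<^sup>2)"
    by (rule bdd[where C="B\<^sup>2"]) (use B h_nonneg in \<open>auto intro!: power_mono\<close>)
  have expand: "f s * (h (t - s) - h t)\<^sup>2 = f s * (h (t - s))\<^sup>2 - 2 * h t * (f s * h (t - s)) + (h t)\<^sup>2 * f s" for s
    by (simp add: power2_eq_square algebra_simps)
  have i3: "integrable lborel (\<lambda>s. f s * (h (t - s) - h t)\<^sup>2)"
    unfolding expand by (intro Bochner_Integration.integrable_add Bochner_Integration.integrable_diff integrable_mult_right i1 i2 f_integrable)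
  have f1: "(\<integral>s. f s \<partial>lborel) = 1"
    by (subst integral_eq_nn_integral) (auto simp: f_nonneg f_density)
  have "ennreal (h t) = ennreal (z t + (\<integral>s. f s * h (t - s) \<partial>lborel))"
    unfolding renewal_all[of t]
    by (subst nn_integral_eq_integral[OF i1])
       (auto simp: f_nonneg h_nonneg z_nonneg intro!: ennreal_plus[symmetric] integral_nonneg_AE)
  then have conv: "(\<integral>s. f s * h (t - s) \<partial>lborel) = h t - z t"
    by (subst (asm) ennreal_inj) (auto simp: f_nonneg h_nonneg z_nonneg intro!: add_nonneg_nonneg integral_nonneg_AE)
  have "(\<integral>s. f s * (h (t - s) - h t)\<^sup>2 \<partial>lborel)
      = (\<integral>s. f s * (h (t - s))\<^sup>2 \<partial>lborel) - 2 * h t * (h t - z t) + (h t)\<^sup>2"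
    unfolding expand using i1 i2 f_integrable by (simp add: conv f1)
  then have "(\<integral>s. f s * (h (t - s) - h t)\<^sup>2 \<partial>lborel) + (h t)\<^sup>2
      = (\<integral>s. f s * (h (t - s))\<^sup>2 \<partial>lborel) + 2 * h t * z t"
    by (simp add: power2_eq_square algebra_simps)
  then show ?thesis
    by (subst nn_integral_eq_integral[OF i3], simp add: f_nonneg)
       (subst nn_integral_eq_integral[OF i2], simp add: f_nonneg,
        simp add: ennreal_plus[symmetric] f_nonneg h_nonneg z_nonneg integral_nonneg_AE del: ennreal_plus)
qed

text \<open>
  Integrating the quadratic identity up to \<open>T\<close>, the terms with \<open>h\<^sup>2\<close> cancel up to a loss of mass in
  the favourable direction, which leaves only the contribution of \<open>z\<close>, uniformly in \<open>T\<close>.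
\<close>

lemma quadratic_bound:
  assumes C: "\<And>t. h t \<le> C"
  shows "(\<integral>\<^sup>+t. (\<integral>\<^sup>+s. ennreal (f s * (h (t - s) - h t)\<^sup>2) \<partial>lborel) \<partial>lborel)
    \<le> ennreal (2 * C) * (\<integral>\<^sup>+t. ennreal (z t) \<partial>lborel)"
proof -
  define V where "V t = (\<integral>\<^sup>+s. ennreal (f s * (h (t - s) - h t)\<^sup>2) \<partial>lborel)" for t
  have [measurable]: "V \<in> borel_measurable borel" unfolding V_def by measurable
  have C0: "C \<ge> 0" using C[of 0] h_nonneg[of 0] by simp
  have trunc: "(\<integral>\<^sup>+t\<in>{..T}. V t \<partial>lborel) \<le> ennreal (2 * C) * (\<integral>\<^sup>+t. ennreal (z t) \<partial>lborel)" for T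
  proof -
    let ?H = "\<integral>\<^sup>+t\<in>{..T}. ennreal ((h t)\<^sup>2) \<partial>lborel"
    have "(\<integral>\<^sup>+t\<in>{..T}. V t \<partial>lborel) + ?H
        = (\<integral>\<^sup>+t\<in>{..T}. (\<integral>\<^sup>+s. ennreal (f s * (h (t - s))\<^sup>2) \<partial>lborel) \<partial>lborel)
        + (\<integral>\<^sup>+t\<in>{..T}. ennreal (2 * h t * z t) \<partial>lborel)"
      by (subst (1 2) nn_integral_add[symmetric], measurable)
         (simp add: V_def distrib_right[symmetric] quadratic_identity)
    also have "\<dots> \<le> ?H + ennreal (2 * C) * (\<integral>\<^sup>+t. ennreal (z t) \<partial>lborel)"
    proof (rule add_mono)
      show "(\<integral>\<^sup>+t\<in>{..T}. (\<integral>\<^sup>+s. ennreal (f s * (h (t - s))\<^sup>2) \<partial>lborel) \<partial>lborel) \<le> ?H"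
        unfolding nn_integral_convolution_density[of "\<lambda>t. (h t)\<^sup>2" T, symmetric, simplified] by simp
      have "(\<integral>\<^sup>+t\<in>{..T}. ennreal (2 * h t * z t) \<partial>lborel) \<le> (\<integral>\<^sup>+t. ennreal (2 * C) * ennreal (z t) \<partial>lborel)"
        using C C0 by (intro nn_integral_mono)
           (auto simp: indicator_def ennreal_mult[symmetric] z_nonneg intro!: ennreal_leI mult_right_mono)
      also have "\<dots> = ennreal (2 * C) * (\<integral>\<^sup>+t. ennreal (z t) \<partial>lborel)"
        by (rule nn_integral_cmult) measurable
      finally show "(\<integral>\<^sup>+t\<in>{..T}. ennreal (2 * h t * z t) \<partial>lborel) \<le> \<dots>" .
    qed
    finally have "?H + (\<integral>\<^sup>+t\<in>{..T}. V t \<partial>lborel) \<le> ?H + ennreal (2 * C) * (\<integral>\<^sup>+t. ennreal (z t) \<partial>lborel)"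
      by (simp add: add.commute)
    moreover have "?H < \<infinity>"
      by (rule nn_integral_atMost_finite[where B="C\<^sup>2"])
         (auto simp: h_neg h_nonneg C intro!: power_mono)
    ultimately show ?thesis by (auto simp: ennreal_add_left_cancel_le)
  qed
  have "(\<integral>\<^sup>+t. V t \<partial>lborel) = (\<integral>\<^sup>+t. (SUP n. V t * indicator {..real n} t) \<partial>lborel)"
  proof (rule nn_integral_cong)
    fix t :: real
    obtain n where "t \<le> real n" using real_arch_simple by blast
    then have "V t \<le> (SUP n. V t * indicator {..real n} t)" by (intro SUP_upper2[of n]) auto
    moreover have "(SUP n. V t * indicator {..real n} t) \<le> V t"
      by (intro SUP_least) (auto simp: indicator_def)
    ultimately show "V t = (SUP n. V t * indicator {..real n} t)" by (rule antisym)
  qed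
  also have "\<dots> = (SUP n. \<integral>\<^sup>+t\<in>{..real n}. V t \<partial>lborel)"
    by (intro nn_integral_monotone_convergence_SUP incseq_SucI) (auto simp: le_fun_def indicator_def)
  also have "\<dots> \<le> ennreal (2 * C) * (\<integral>\<^sup>+t. ennreal (z t) \<partial>lborel)"
    by (intro SUP_least trunc)
  finally show ?thesis by (simp add: V_def)
qed

text \<open>
  Exchanging the integrals in the quadratic bound, almost every \<open>s\<close> with \<open>f s > 0\<close> has a
  square-integrable increment \<open>\<lambda>t. h (t - s) - h t\<close>.  These \<open>s\<close> fill a set of positive measure, so
  they are uncountably many.
\<close>

lemma increments_tendsto_zero:
  assumes C: "\<And>t. h t \<le> C"
    and lip: "\<And>s t. 0 \<le> s \<Longrightarrow> s \<le> t \<Longrightarrow> \<bar>h t - h s\<bar> \<le> K * (t - s)"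
    and z: "(\<integral>\<^sup>+t. ennreal (z t) \<partial>lborel) < \<infinity>"
  shows "((\<lambda>t. h (t + d) - h t) \<longlongrightarrow> 0) at_top"
proof (rule lipschitz_increments_tendsto_zero[OF lip])
  define D where "D = {d. ((\<lambda>t. h (t + d) - h t) \<longlongrightarrow> 0) at_top}"
  have K: "K \<ge> 0" using lip[of 0 1] by auto
  have "(\<integral>\<^sup>+s. (\<integral>\<^sup>+t. ennreal (f s * (h (t - s) - h t)\<^sup>2) \<partial>lborel) \<partial>lborel)
      = (\<integral>\<^sup>+t. (\<integral>\<^sup>+s. ennreal (f s * (h (t - s) - h t)\<^sup>2) \<partial>lborel) \<partial>lborel)"
    by (rule lborel_pair.Fubini') measurable
  also have "\<dots> < \<infinity>"
    using quadratic_bound[OF C] z by (auto simp: ennreal_mult_less_top intro: le_less_trans)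
  finally have "AE s in lborel. (\<integral>\<^sup>+t. ennreal (f s * (h (t - s) - h t)\<^sup>2) \<partial>lborel) \<noteq> \<infinity>"
    by (intro nn_integral_PInf_AE) auto
  then have AE_D: "AE s in lborel. f s = 0 \<or> s \<in> D"
  proof eventually_elim
    case (elim s)
    show ?case
    proof (cases "f s > 0")
      case True
      have "(\<integral>\<^sup>+t. ennreal ((h (t - s) - h t)\<^sup>2) \<partial>lborel) < \<infinity>"
        using elim True by (simp add: ennreal_mult f_nonneg nn_integral_cmult ennreal_mult_eq_top_iff less_top)
      then have "((\<lambda>t. h (t - s) - h t) \<longlongrightarrow> 0) at_top"
      proof (rule square_integrable_lipschitz_tendsto_zero[rotated, where a="\<bar>s\<bar>" and K="2 * K"])
        fix x y assume xy: "\<bar>s\<bar> \<le> x" "x \<le> y"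
        then show "\<bar>(h (y - s) - h y) - (h (x - s) - h x)\<bar> \<le> 2 * K * (y - x)"
          using lip[of "x - s" "y - s"] lip[of x y] by (simp add: abs_le_iff algebra_simps)
      qed measurable
      then have "((\<lambda>t. - (h (t + s - s) - h (t + s))) \<longlongrightarrow> - 0) at_top"
        by (intro tendsto_minus tendsto_at_top_shift[of "\<lambda>t. h (t - s) - h t"])
      then show ?thesis by (simp add: D_def)
    qed (use f_nonneg[of s] in simp)
  qed
  show "uncountable {d. ((\<lambda>t. h (t + d) - h t) \<longlongrightarrow> 0) at_top}"
  proof
    assume "countable {d. ((\<lambda>t. h (t + d) - h t) \<longlongrightarrow> 0) at_top}"
    then have "D \<in> null_sets lborel" unfolding D_def by (rule countable_imp_null_set_lborel)
    then have "AE s in lborel. s \<notin> D" by (rule AE_not_in)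
    with AE_D have "AE s in lborel. ennreal (f s) = 0" by eventually_elim auto
    then have "(\<integral>\<^sup>+s. ennreal (f s) \<partial>lborel) = (\<integral>\<^sup>+(s::real). 0 \<partial>lborel)" by (rule nn_integral_cong_AE)
    then show False using f_density by simp
  qed
qed

text \<open>
  In the conservation law \<open>h (t - s)\<close> may be replaced by \<open>h t\<close> in the limit, by dominated convergence
  with the integrable majorant \<open>C * tail s\<close>; the left-hand side then becomes \<open>h t\<close> times the mean.
\<close>

lemma key_renewal_lipschitz:
  assumes C: "\<And>t. h t \<le> C"
    and lip: "\<And>s t. 0 \<le> s \<Longrightarrow> s \<le> t \<Longrightarrow> \<bar>h t - h s\<bar> \<le> K * (t - s)"
    and z: "integrable lborel z"
    and fin: "mean < \<infinity>"
  shows "(h \<longlongrightarrow> (\<integral>t. z t \<partial>lborel) / enn2real mean) at_top"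
proof -
  define m where "m = enn2real mean"
  have m: "m > 0" unfolding m_def using mean_pos fin by (simp add: enn2real_positive_iff)
  have z': "(\<integral>\<^sup>+t. ennreal (z t) \<partial>lborel) < \<infinity>"
    using z by (subst nn_integral_eq_integral) (auto simp: z_nonneg)
  have incr: "((\<lambda>t. h (t + d) - h t) \<longlongrightarrow> 0) at_top" for d
    by (rule increments_tendsto_zero[OF C lip z'])
  let ?w = "\<lambda>s. indicator {0..} s *\<^sub>R tail s"
  have w: "integrable lborel ?w" "(\<integral>s. ?w s \<partial>lborel) = m"
    unfolding m_def by (intro tail_integrable fin)+
  have "((\<lambda>t. \<integral>s. ?w s * (h (t - s) - h t) \<partial>lborel) \<longlongrightarrow> (\<integral>s. ?w s * 0 \<partial>(lborel::real measure))) at_top"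
  proof (rule integral_dominated_convergence_at_top[where w="\<lambda>s. ?w s * C"])
    show "integrable lborel (\<lambda>s. ?w s * C)" by (intro integrable_mult_left w)
    show "AE s in lborel. ((\<lambda>t. ?w s * (h (t - s) - h t)) \<longlongrightarrow> ?w s * 0) at_top"
      using incr[of "- s" for s] by (intro AE_I2 tendsto_intros) simp
    have "\<bar>h (t - s) - h t\<bar> \<le> C" for s t
      using C[of t] C[of "t - s"] h_nonneg[of t] h_nonneg[of "t - s"] by linarith
    then show "eventually (\<lambda>t. AE s in lborel. norm (?w s * (h (t - s) - h t)) \<le> ?w s * C) at_top"
      by (intro always_eventually allI AE_I2) (auto simp: abs_mult tail_nonneg intro!: mult_left_mono)
  qed measurable
  moreover have "(\<integral>s. ?w s * (h (t - s) - h t) \<partial>lborel) = (\<integral>u. indicator {..t} u *\<^sub>R z u \<partial>lborel) - m * h t" for t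
  proof -
    have "(\<integral>s. ?w s * (h (t - s) - h t) \<partial>lborel)
        = (\<integral>s. indicator {0..} s *\<^sub>R (tail s * h (t - s)) - ?w s * h t \<partial>lborel)"
      by (intro Bochner_Integration.integral_cong) (auto simp: algebra_simps)
    also have "\<dots> = (\<integral>u. indicator {..t} u *\<^sub>R z u \<partial>lborel) - m * h t"
      using conservation[of t] w by (subst Bochner_Integration.integral_diff) auto
    finally show ?thesis .
  qed
  ultimately have "((\<lambda>t. (\<integral>u. indicator {..t} u *\<^sub>R z u \<partial>lborel) - m * h t) \<longlongrightarrow> 0) at_top"
    by simp
  moreover have "((\<lambda>t. \<integral>u. indicator {..t} u *\<^sub>R z u \<partial>lborel) \<longlongrightarrow> (\<integral>u. z u \<partial>lborel)) at_top"
    by (rule tendsto_integral_at_top) (use z in auto)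
  ultimately have "((\<lambda>t. ((\<integral>u. indicator {..t} u *\<^sub>R z u \<partial>lborel)
      - ((\<integral>u. indicator {..t} u *\<^sub>R z u \<partial>lborel) - m * h t)) / m) \<longlongrightarrow> ((\<integral>u. z u \<partial>lborel) - 0) / m) at_top"
    using m by (intro tendsto_intros) auto
  then show ?thesis using m by (simp add: m_def)
qed

end

section \<open>The renewal equation for exponential moments of occupation times\<close>

text \<open>
  This is the fundamental theorem of calculus for \<open>- a ^ Suc n\<close>, whose derivative is
  \<open>Suc n * y * a ^ n\<close>.  Since \<open>y\<close> is merely measurable, the proof is by induction on \<open>n\<close>
  with Tonelli's theorem: for \<open>b v\<close> the integral of \<open>y\<close> over \<open>[s, v]\<close>, the induction hypothesis
  turns the next power into an integral against \<open>b\<close>, and \<open>b v + a v = a s\<close> closes the recursion.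
\<close>

lemma nn_integral_occupation_power:
  fixes y :: "real \<Rightarrow> ennreal" and t :: real
  assumes [measurable]: "y \<in> borel_measurable borel"
  defines "a \<equiv> \<lambda>s. (\<integral>\<^sup>+u\<in>{s..t}. y u \<partial>lborel)"
  shows "of_nat (Suc n) * (\<integral>\<^sup>+u\<in>{s..t}. y u * a u ^ n \<partial>lborel) = a s ^ Suc n"
proof (induction n arbitrary: s)
  case 0
  show ?case by (simp add: a_def)
next
  case (Suc n)
  have [measurable]: "a \<in> borel_measurable borel"
    unfolding a_def by measurable
  define b where "b v = (\<integral>\<^sup>+u\<in>{s..v}. y u \<partial>lborel)" for v
  have [measurable]: "b \<in> borel_measurable borel" unfolding b_def by measurable
  let ?J = "\<lambda>n. \<integral>\<^sup>+u\<in>{s..t}. y u * a u ^ n \<partial>lborel"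
  have ab: "b v + a v = a s" if "v \<in> {s..t}" for v
  proof -
    have "b v + a v = (\<integral>\<^sup>+u. y u * indicator {s..v} u + y u * indicator {v..t} u \<partial>lborel)"
      unfolding a_def b_def by (rule nn_integral_add[symmetric]) measurable
    also have "\<dots> = a s" unfolding a_def
    proof (rule nn_integral_cong_AE)
      have "AE u in lborel. u \<noteq> v" by (rule AE_lborel_singleton)
      then show "AE u in lborel. y u * indicator {s..v} u + y u * indicator {v..t} u = y u * indicator {s..t} u"
        by eventually_elim (use that in \<open>auto simp: indicator_def\<close>)
    qed
    finally show ?thesis .
  qed
  have "?J (Suc n) = (\<integral>\<^sup>+u\<in>{s..t}. y u * (of_nat (Suc n) * (\<integral>\<^sup>+v\<in>{u..t}. y v * a v ^ n \<partial>lborel)) \<partial>lborel)"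
    unfolding Suc.IH ..
  also have "\<dots> = (\<integral>\<^sup>+u. (\<integral>\<^sup>+v. y u * indicator {s..t} u * (of_nat (Suc n) * (y v * a v ^ n * indicator {u..t} v)) \<partial>lborel) \<partial>lborel)"
    by (subst nn_integral_cmult[symmetric], measurable, subst nn_integral_cmult[symmetric], measurable,
        subst nn_integral_multc[symmetric], measurable, simp add: ac_simps)
  also have "\<dots> = (\<integral>\<^sup>+v. (\<integral>\<^sup>+u. y u * indicator {s..t} u * (of_nat (Suc n) * (y v * a v ^ n * indicator {u..t} v)) \<partial>lborel) \<partial>lborel)"
    by (rule lborel_pair.Fubini') measurable
  also have "\<dots> = (\<integral>\<^sup>+v. (\<integral>\<^sup>+u. (of_nat (Suc n) * (y v * a v ^ n * indicator {s..t} v)) * (y u * indicator {s..v} u) \<partial>lborel) \<partial>lborel)"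
    by (intro nn_integral_cong) (auto simp: indicator_def ac_simps)
  also have "\<dots> = (\<integral>\<^sup>+v. (of_nat (Suc n) * (y v * a v ^ n * indicator {s..t} v)) * b v \<partial>lborel)"
    unfolding b_def by (subst nn_integral_cmult) auto
  finally have J: "?J (Suc n) = (\<integral>\<^sup>+v. (of_nat (Suc n) * (y v * a v ^ n * indicator {s..t} v)) * b v \<partial>lborel)" .
  have "of_nat (Suc (Suc n)) * ?J (Suc n) = ?J (Suc n) + of_nat (Suc n) * ?J (Suc n)"
    by (simp only: of_nat_Suc distrib_right mult_1)
  also have "\<dots> = (\<integral>\<^sup>+v. (of_nat (Suc n) * (y v * a v ^ n * indicator {s..t} v)) * b v \<partial>lborel)
      + (\<integral>\<^sup>+v. of_nat (Suc n) * (y v * a v ^ Suc n * indicator {s..t} v) \<partial>lborel)"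
    by (subst J) (simp add: nn_integral_cmult)
  also have "\<dots> = (\<integral>\<^sup>+v. (of_nat (Suc n) * (y v * a v ^ n * indicator {s..t} v)) * (b v + a v) \<partial>lborel)"
  proof (subst nn_integral_add[symmetric])
    show "(\<integral>\<^sup>+v. of_nat (Suc n) * (y v * a v ^ n * indicator {s..t} v) * b v
        + of_nat (Suc n) * (y v * a v ^ Suc n * indicator {s..t} v) \<partial>lborel) =
      (\<integral>\<^sup>+v. of_nat (Suc n) * (y v * a v ^ n * indicator {s..t} v) * (b v + a v) \<partial>lborel)"
      unfolding distrib_left power_Suc2 by (simp only: mult.assoc mult.commute[of "indicator _ _"])
  qed measurable
  also have "\<dots> = (\<integral>\<^sup>+v. a s * (of_nat (Suc n) * (y v * a v ^ n * indicator {s..t} v)) \<partial>lborel)"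
  proof (rule nn_integral_cong)
    fix v
    show "(of_nat (Suc n) * (y v * a v ^ n * indicator {s..t} v)) * (b v + a v)
      = a s * (of_nat (Suc n) * (y v * a v ^ n * indicator {s..t} v))"
      using ab[of v] by (cases "v \<in> {s..t}") (auto simp: mult.commute)
  qed
  also have "\<dots> = a s * (of_nat (Suc n) * ?J n)"
    by (simp add: nn_integral_cmult)
  also have "\<dots> = a s ^ Suc (Suc n)" unfolding Suc.IH by simp
  finally show ?case .
qed

locale markov_state = markov_process S \<Omega> P X
  for S :: "'s set" and \<Omega> :: "'w measure" and P :: "'s \<Rightarrow> 'w measure" and X :: "real \<Rightarrow> 'w \<Rightarrow> 's" +
  fixes i :: 's
  assumes state: "i \<in> S"
begin

sublocale Q: prob_space "P i" by (rule prob_space_P[OF state])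

text \<open>
  Clamping the time at 0 makes the indicator measurable on the whole real line times the sample
  space; nonnegative times are unaffected.
\<close>

definition visit :: "real \<Rightarrow> 'w \<Rightarrow> ennreal" where
  "visit s \<omega> = indicator {i} (X (max 0 s) \<omega>)"

definition return_prob :: "real \<Rightarrow> real" where
  "return_prob s = trans_prob P X (max 0 s) i i"

lemma visit_measurable: "(\<lambda>(s, \<omega>). visit s \<omega>) \<in> borel_measurable (borel \<Otimes>\<^sub>M P i)"
proof -
  have [measurable_cong]: "sets (P i) = sets \<Omega>" by (rule sets_P[OF state])
  have "(\<lambda>z. (max 0 (fst z), snd z)) \<in> borel \<Otimes>\<^sub>M P i \<rightarrow>\<^sub>M restrict_space borel {0::real..} \<Otimes>\<^sub>M \<Omega>"
  proof (rule measurable_Pair)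
    show "(\<lambda>z. max 0 (fst z)) \<in> borel \<Otimes>\<^sub>M P i \<rightarrow>\<^sub>M restrict_space borel {0::real..}"
      by (rule measurable_restrict_space2) (auto simp: space_pair_measure)
  qed measurable
  from measurable_compose[OF this measurable_X]
  have "(\<lambda>z. X (max 0 (fst z)) (snd z)) \<in> borel \<Otimes>\<^sub>M P i \<rightarrow>\<^sub>M count_space S" by simp
  then have "(\<lambda>z. indicator {i} (X (max 0 (fst z)) (snd z)) :: ennreal) \<in> borel_measurable (borel \<Otimes>\<^sub>M P i)"
    by (rule measurable_compose) simp
  then show ?thesis by (simp add: visit_def case_prod_beta')
qed

lemma measurable_visit [measurable (raw)]:
  assumes [measurable]: "f \<in> borel_measurable M" "g \<in> M \<rightarrow>\<^sub>M P i"
  shows "(\<lambda>x. visit (f x) (g x)) \<in> borel_measurable M"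
proof -
  have "(\<lambda>x. (f x, g x)) \<in> M \<rightarrow>\<^sub>M borel \<Otimes>\<^sub>M P i" by measurable
  from measurable_compose[OF this visit_measurable] show ?thesis by simp
qed

lemma visit_idem: "visit s \<omega> * visit s \<omega> = visit s \<omega>"
  by (simp add: visit_def indicator_def)

definition stay :: "real set \<Rightarrow> 'w \<Rightarrow> ennreal" where
  "stay T \<omega> = (\<Prod>r\<in>T. visit r \<omega>)"

lemma measurable_stay [measurable]: "stay T \<in> borel_measurable (P i)"
  unfolding stay_def by measurable

text \<open>
  Inserting a time that is already present is harmless because indicators are idempotent.
\<close>

lemma stay_insert: "finite T \<Longrightarrow> stay (insert u T) \<omega> = stay T \<omega> * visit u \<omega>"
proof (cases "u \<in> T")
  case True
  assume "finite T"
  then have *: "stay T \<omega> = visit u \<omega> * stay (T - {u}) \<omega>"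
    unfolding stay_def using True by (rule prod.remove)
  have "stay T \<omega> * visit u \<omega> = visit u \<omega> * visit u \<omega> * stay (T - {u}) \<omega>"
    unfolding * by (simp only: ac_simps)
  also have "\<dots> = stay T \<omega>" unfolding visit_idem * ..
  finally show ?thesis using True by (simp add: insert_absorb)
qed (simp add: stay_def mult.commute)

lemma nn_integral_stay:
  assumes "finite T" "T \<subseteq> {0..}"
  shows "(\<integral>\<^sup>+\<omega>. stay T \<omega> \<partial>P i) = ennreal \<P>(\<omega> in P i. \<forall>r\<in>T. X r \<omega> = i)"
    and "{\<omega> \<in> space (P i). \<forall>r\<in>T. X r \<omega> = i} \<in> sets (P i)"
proof -
  have stay: "stay T \<omega> = indicator {\<omega> \<in> space (P i). \<forall>r\<in>T. X r \<omega> = i} \<omega>" if "\<omega> \<in> space (P i)" for \<omega>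
  proof (cases "\<forall>r\<in>T. X r \<omega> = i")
    case True
    then have "stay T \<omega> = (\<Prod>r\<in>T. 1)"
      unfolding stay_def
    proof (intro prod.cong refl)
      fix r assume "r \<in> T"
      then have "r \<ge> 0" "X r \<omega> = i" using assms True by auto
      then show "visit r \<omega> = 1" by (simp add: visit_def max_def)
    qed
    then show ?thesis using True that by simp
  next
    case False
    then obtain r where r: "r \<in> T" "X r \<omega> \<noteq> i" by blast
    then have "r \<ge> 0" using assms by auto
    then have "visit r \<omega> = 0" using r by (simp add: visit_def max_def)
    then have "stay T \<omega> = 0" unfolding stay_def using r assms by (intro prod_zero bexI[of _ r])
    then show ?thesis using False by auto
  qed
  have "{\<omega> \<in> space (P i). stay T \<omega> = 1} \<in> sets (P i)" by measurable
  moreover have "{\<omega> \<in> space (P i). stay T \<omega> = 1} = {\<omega> \<in> space (P i). \<forall>r\<in>T. X r \<omega> = i}"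
    by (rule Collect_cong) (use stay in \<open>simp add: indicator_def cong: conj_cong\<close>)
  ultimately show *: "{\<omega> \<in> space (P i). \<forall>r\<in>T. X r \<omega> = i} \<in> sets (P i)" by simp
  have "(\<integral>\<^sup>+\<omega>. stay T \<omega> \<partial>P i) = (\<integral>\<^sup>+\<omega>. indicator {\<omega> \<in> space (P i). \<forall>r\<in>T. X r \<omega> = i} \<omega> \<partial>P i)"
    by (rule nn_integral_cong) (rule stay)
  also have "\<dots> = emeasure (P i) {\<omega> \<in> space (P i). \<forall>r\<in>T. X r \<omega> = i}"
    using * by simp
  finally show "(\<integral>\<^sup>+\<omega>. stay T \<omega> \<partial>P i) = ennreal \<P>(\<omega> in P i. \<forall>r\<in>T. X r \<omega> = i)"
    by (simp add: Q.emeasure_eq_measure)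
qed

lemma return_prob_eq_nn_integral: "ennreal (return_prob s) = (\<integral>\<^sup>+\<omega>. visit s \<omega> \<partial>P i)"
proof -
  have "(\<integral>\<^sup>+\<omega>. visit s \<omega> \<partial>P i) = (\<integral>\<^sup>+\<omega>. stay {max 0 s} \<omega> \<partial>P i)"
    by (simp add: stay_def visit_def)
  also have "\<dots> = ennreal (return_prob s)"
    by (subst nn_integral_stay) (auto simp: return_prob_def trans_prob_def)
  finally show ?thesis by simp
qed

lemma return_prob_nonneg: "0 \<le> return_prob s"
  and return_prob_le_1: "return_prob s \<le> 1"
  by (auto simp: return_prob_def trans_prob_def)

lemma return_prob_measurable [measurable]: "return_prob \<in> borel_measurable borel"
proof -
  have "(\<lambda>s. enn2real (\<integral>\<^sup>+\<omega>. visit s \<omega> \<partial>P i)) \<in> borel_measurable borel" by measurable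
  then show ?thesis
    unfolding return_prob_eq_nn_integral[symmetric] by (simp add: return_prob_nonneg)
qed

lemma stay_markov:
  assumes T: "finite T" "s \<in> T" "T \<subseteq> {0..s}" and u: "s \<le> u"
  shows "(\<integral>\<^sup>+\<omega>. stay (insert u T) \<omega> \<partial>P i) = (\<integral>\<^sup>+\<omega>. stay T \<omega> \<partial>P i) * ennreal (return_prob (u - s))"
proof -
  let ?A = "\<P>(\<omega> in P i. \<forall>r\<in>T. X r \<omega> = i)"
  have T0: "T \<subseteq> {0..}" "insert u T \<subseteq> {0..}" using T u by (auto simp: subset_iff)
  show ?thesis
  proof (cases "?A > 0")
    case True
    have "\<P>(\<omega> in P i. X (s + (u - s)) \<omega> = i \<bar> \<forall>r\<in>T. X r \<omega> = i) = \<P>(\<omega> in P i. X (u - s) \<omega> = i)"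
      by (rule markov_property[where a = "\<lambda>_. i", OF state state _ T(1,3,2)]) (use u True in auto)
    then have "\<P>(\<omega> in P i. X u \<omega> = i \<and> (\<forall>r\<in>T. X r \<omega> = i)) / ?A = return_prob (u - s)"
      using u by (simp add: cond_prob_def return_prob_def trans_prob_def)
    then have "\<P>(\<omega> in P i. X u \<omega> = i \<and> (\<forall>r\<in>T. X r \<omega> = i)) = ?A * return_prob (u - s)"
      using True unfolding nonzero_divide_eq_eq[OF less_imp_neq[OF True, symmetric]] by (simp only: mult.commute)
    then have eq: "\<P>(\<omega> in P i. \<forall>r\<in>insert u T. X r \<omega> = i) = ?A * return_prob (u - s)"
      by simp
    have "(\<integral>\<^sup>+\<omega>. stay (insert u T) \<omega> \<partial>P i) = ennreal (?A * return_prob (u - s))"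
      unfolding eq[symmetric] by (rule nn_integral_stay(1)) (use T0 T in auto)
    also have "\<dots> = ennreal ?A * ennreal (return_prob (u - s))"
      by (rule ennreal_mult) (simp_all add: return_prob_nonneg)
    also have "ennreal ?A = (\<integral>\<^sup>+\<omega>. stay T \<omega> \<partial>P i)"
      by (rule nn_integral_stay(1)[symmetric]) (use T0 T in auto)
    finally show ?thesis .
  next
    case False
    then have "?A = 0" by (simp only: not_less measure_le_0_iff)
    then have "(\<integral>\<^sup>+\<omega>. stay T \<omega> \<partial>P i) = 0"
      using nn_integral_stay(1)[OF T(1) T0(1)] by simp
    moreover have "(\<integral>\<^sup>+\<omega>. stay (insert u T) \<omega> \<partial>P i) \<le> (\<integral>\<^sup>+\<omega>. stay T \<omega> \<partial>P i)"
      using T by (intro nn_integral_mono) (auto simp: stay_insert visit_def indicator_def)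
    ultimately show ?thesis by simp
  qed
qed

definition occupation :: "real \<Rightarrow> real \<Rightarrow> 'w \<Rightarrow> ennreal" where
  "occupation s t \<omega> = (\<integral>\<^sup>+u\<in>{s..t}. visit u \<omega> \<partial>lborel)"

lemma measurable_occupation [measurable (raw)]:
  assumes [measurable]: "f \<in> borel_measurable M" "g \<in> M \<rightarrow>\<^sub>M P i"
  shows "(\<lambda>x. occupation (f x) t (g x)) \<in> borel_measurable M"
  unfolding occupation_def by measurable

text \<open>
  The moments of the occupation time as iterated convolutions.  The factor \<open>Suc n\<close> counts which of
  the \<open>Suc n\<close> recorded times is the smallest.
\<close>

fun occ_moment :: "nat \<Rightarrow> real \<Rightarrow> ennreal" where
  "occ_moment 0 t = 1"
| "occ_moment (Suc n) t =
    of_nat (Suc n) * (\<integral>\<^sup>+u\<in>{0..t}. ennreal (return_prob u) * occ_moment n (t - u) \<partial>lborel)"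

lemma measurable_occ_moment [measurable]: "occ_moment n \<in> borel_measurable borel"
proof (induction n)
  case (Suc n)
  note [measurable] = Suc
  show ?case unfolding occ_moment.simps[abs_def] by measurable
qed simp

text \<open>
  Write the power of the occupation of \<open>[s, t]\<close> as an integral over the smallest \<open>u\<close> of the times that
  it records, with one power less of the occupation of \<open>[u, t]\<close>.  Adding \<open>u\<close> to the observed times
  \<open>T\<close> keeps the induction hypothesis applicable, and the Markov property at \<open>s\<close> splits off the
  factor \<open>return_prob (u - s)\<close>.  Quantifying over all finite \<open>T\<close> is what replaces a Markov property
  for the whole future path.
\<close>

lemma nn_integral_stay_occupation_power:
  assumes "finite T" "s \<in> T" "T \<subseteq> {0..s}" "s \<le> t"
  shows "(\<integral>\<^sup>+\<omega>. stay T \<omega> * occupation s t \<omega> ^ n \<partial>P i) = (\<integral>\<^sup>+\<omega>. stay T \<omega> \<partial>P i) * occ_moment n (t - s)"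
  using assms
proof (induction n arbitrary: T s)
  case 0
  then show ?case by simp
next
  case (Suc n)
  let ?c = "\<integral>\<^sup>+\<omega>. stay T \<omega> \<partial>P i"
  have "(\<integral>\<^sup>+\<omega>. stay T \<omega> * occupation s t \<omega> ^ Suc n \<partial>P i)
      = (\<integral>\<^sup>+\<omega>. (\<integral>\<^sup>+u. of_nat (Suc n) * (stay T \<omega> * visit u \<omega> * occupation u t \<omega> ^ n * indicator {s..t} u) \<partial>lborel) \<partial>P i)"
  proof (rule nn_integral_cong)
    fix \<omega> assume [measurable]: "\<omega> \<in> space (P i)"
    have [measurable]: "(\<lambda>u. visit u \<omega>) \<in> borel_measurable borel"
      "(\<lambda>u. occupation u t \<omega>) \<in> borel_measurable borel" by measurable
    show "stay T \<omega> * occupation s t \<omega> ^ Suc n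
      = (\<integral>\<^sup>+u. of_nat (Suc n) * (stay T \<omega> * visit u \<omega> * occupation u t \<omega> ^ n * indicator {s..t} u) \<partial>lborel)"
    proof -
      have "of_nat (Suc n) * (\<integral>\<^sup>+u\<in>{s..t}. visit u \<omega> * occupation u t \<omega> ^ n \<partial>lborel) = occupation s t \<omega> ^ Suc n"
        unfolding occupation_def by (rule nn_integral_occupation_power) measurable
      then have "stay T \<omega> * occupation s t \<omega> ^ Suc n
        = stay T \<omega> * of_nat (Suc n) * (\<integral>\<^sup>+u\<in>{s..t}. visit u \<omega> * occupation u t \<omega> ^ n \<partial>lborel)"
        by (simp only: mult.assoc)
      also have "\<dots> = (\<integral>\<^sup>+u. stay T \<omega> * of_nat (Suc n) * (visit u \<omega> * occupation u t \<omega> ^ n * indicator {s..t} u) \<partial>lborel)"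
        by (rule nn_integral_cmult[symmetric]) measurable
      finally show ?thesis by (simp only: mult.assoc mult.left_commute[of "stay T \<omega>"])
    qed
  qed
  also have "\<dots> = (\<integral>\<^sup>+u. (\<integral>\<^sup>+\<omega>. of_nat (Suc n) * (stay T \<omega> * visit u \<omega> * occupation u t \<omega> ^ n * indicator {s..t} u) \<partial>P i) \<partial>lborel)"
  proof -
    interpret pair_sigma_finite lborel "P i" ..
    show ?thesis by (rule Fubini') measurable
  qed
  also have "\<dots> = (\<integral>\<^sup>+u. (\<lambda>v. ?c * of_nat (Suc n) * (ennreal (return_prob v) * occ_moment n (t - s - v) * indicator {0..t - s} v)) (u - s) \<partial>lborel)"
  proof (rule nn_integral_cong)
    fix u
    show "(\<integral>\<^sup>+\<omega>. of_nat (Suc n) * (stay T \<omega> * visit u \<omega> * occupation u t \<omega> ^ n * indicator {s..t} u) \<partial>P i)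
      = (\<lambda>v. ?c * of_nat (Suc n) * (ennreal (return_prob v) * occ_moment n (t - s - v) * indicator {0..t - s} v)) (u - s)"
    proof (cases "u \<in> {s..t}")
      case True
      have "(\<integral>\<^sup>+\<omega>. of_nat (Suc n) * (stay T \<omega> * visit u \<omega> * occupation u t \<omega> ^ n * indicator {s..t} u) \<partial>P i)
         = of_nat (Suc n) * (\<integral>\<^sup>+\<omega>. stay (insert u T) \<omega> * occupation u t \<omega> ^ n \<partial>P i)"
        using True Suc.prems(1) by (subst nn_integral_cmult) (simp_all only: stay_insert indicator_simps mult_1_right, measurable)
      also have "(\<integral>\<^sup>+\<omega>. stay (insert u T) \<omega> * occupation u t \<omega> ^ n \<partial>P i) = (\<integral>\<^sup>+\<omega>. stay (insert u T) \<omega> \<partial>P i) * occ_moment n (t - u)"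
        using Suc.prems True by (intro Suc.IH) (auto simp: subset_iff)
      also have "(\<integral>\<^sup>+\<omega>. stay (insert u T) \<omega> \<partial>P i) = ?c * ennreal (return_prob (u - s))"
        using Suc.prems True by (intro stay_markov) auto
      finally have "(\<integral>\<^sup>+\<omega>. of_nat (Suc n) * (stay T \<omega> * visit u \<omega> * occupation u t \<omega> ^ n * indicator {s..t} u) \<partial>P i)
        = of_nat (Suc n) * (?c * ennreal (return_prob (u - s)) * occ_moment n (t - u))" .
      moreover have "t - s - (u - s) = t - u" "u - s \<in> {0..t - s}" using True by auto
      ultimately show ?thesis by (simp only: indicator_simps mult_1_right mult.assoc mult.left_commute[of ?c])
    next
      case False
      then have "u - s \<notin> {0..t - s}" by auto
      with False have "indicator {s..t} u = (0::ennreal)" "indicator {0..t - s} (u - s) = (0::ennreal)"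
        by (auto simp: indicator_def)
      then show ?thesis by simp
    qed
  qed
  also have "\<dots> = (\<integral>\<^sup>+v. ?c * of_nat (Suc n) * (ennreal (return_prob v) * occ_moment n (t - s - v) * indicator {0..t - s} v) \<partial>lborel)"
    using nn_integral_lborel_translate[of "\<lambda>v. ?c * of_nat (Suc n) * (ennreal (return_prob v) * occ_moment n (t - s - v) * indicator {0..t - s} v)" "- s"]
    by simp
  also have "\<dots> = ?c * occ_moment (Suc n) (t - s)"
    by (simp add: nn_integral_cmult mult.assoc)
  finally show ?case .
qed

lemma
  assumes [measurable]: "\<omega> \<in> space (P i)"
  shows occupation_eq_occ_time: "occupation 0 t \<omega> = ennreal (occ_time X i t \<omega>)"
    and occ_time_mono: "s \<le> t \<Longrightarrow> occ_time X i s \<omega> \<le> occ_time X i t \<omega>"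
    and occ_time_increment_le: "0 \<le> s \<Longrightarrow> s \<le> t \<Longrightarrow> occ_time X i t \<omega> \<le> occ_time X i s \<omega> + (t - s)"
    and occ_time_nonneg: "0 \<le> occ_time X i t \<omega>"
proof -
  define y where "y u = (indicator {i} (X (max 0 u) \<omega>) :: real)" for u
  have vis: "visit u \<omega> = ennreal (y u)" for u by (simp add: visit_def y_def indicator_def)
  have y01: "0 \<le> y u" "y u \<le> 1" for u by (auto simp: y_def)
  have "(\<lambda>u. enn2real (visit u \<omega>)) \<in> borel_measurable borel" by measurable
  then have [measurable]: "y \<in> borel_measurable borel" by (simp add: vis y01)
  have occ: "occ_time X i t \<omega> = (\<integral>u. indicator {0..t} u *\<^sub>R y u \<partial>lborel)" for t
    unfolding occ_time_def set_lebesgue_integral_def y_def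
    by (intro Bochner_Integration.integral_cong) (auto simp: indicator_def)
  have int: "integrable lborel (\<lambda>u. indicator {0..t} u *\<^sub>R y u)" for t
  proof (rule Bochner_Integration.integrable_bound[where f="\<lambda>s. indicator {0..t} s *\<^sub>R (1::real)"])
    show "integrable lborel (\<lambda>s. indicator {0..t} s *\<^sub>R (1::real))"
      by (intro integrable_scaleR_left integrable_real_indicator) (auto simp: emeasure_lborel_Icc_eq)
  qed (auto simp: indicator_def y01)
  show "0 \<le> occ_time X i t \<omega>" unfolding occ by (intro integral_nonneg_AE) (auto simp: y01)
  show "occupation 0 t \<omega> = ennreal (occ_time X i t \<omega>)"
    unfolding occ occupation_def
    by (subst nn_integral_eq_integral[OF int, symmetric])
       (auto simp: y01 vis indicator_def intro!: nn_integral_cong)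
  show "occ_time X i s \<omega> \<le> occ_time X i t \<omega>" if "s \<le> t"
    unfolding occ using that by (intro integral_mono int) (auto simp: indicator_def y01)
  show "occ_time X i t \<omega> \<le> occ_time X i s \<omega> + (t - s)" if "0 \<le> s" "s \<le> t"
  proof -
    have i2: "integrable lborel (indicator {s<..t} :: real \<Rightarrow> real)"
      using that by (intro integrable_real_indicator) auto
    have "occ_time X i t \<omega> \<le> (\<integral>u. indicator {0..s} u *\<^sub>R y u + indicator {s<..t} u \<partial>lborel)"
      unfolding occ using that
      by (intro integral_mono int Bochner_Integration.integrable_add i2) (auto simp: indicator_def y01)
    also have "\<dots> = occ_time X i s \<omega> + (t - s)"
      unfolding occ using int i2 that by simp
    finally show ?thesis .
  qed
qed

lemma occ_time_measurable [measurable]: "occ_time X i t \<in> borel_measurable (P i)"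
proof -
  have "(\<lambda>\<omega>. enn2real (occupation 0 t \<omega>)) \<in> borel_measurable (P i)" by measurable
  then show ?thesis
    by (rule measurable_cong[THEN iffD1, rotated]) (simp add: occupation_eq_occ_time occ_time_nonneg)
qed

lemma occ_time_0: "occ_time X i 0 \<omega> = 0"
proof -
  have "AE u in lborel. u \<noteq> (0::real)" by (rule AE_lborel_singleton)
  then have "AE u in lborel. indicator {0..0::real} u *\<^sub>R indicator {i} (X u \<omega>) = (0::real)"
    by eventually_elim (simp add: indicator_def)
  then show ?thesis
    unfolding occ_time_def set_lebesgue_integral_def by (rule integral_eq_zero_AE)
qed

lemma occ_time_le: "\<omega> \<in> space (P i) \<Longrightarrow> 0 \<le> t \<Longrightarrow> occ_time X i t \<omega> \<le> t"
  using occ_time_increment_le[of \<omega> 0 t] by (simp add: occ_time_0)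

lemma exp_occ_integrable:
  assumes "0 \<le> \<gamma>" "0 \<le> t"
  shows "integrable (P i) (\<lambda>\<omega>. exp (\<gamma> * occ_time X i t \<omega>))"
  by (rule Q.integrable_const_bound[where B="exp (\<gamma> * t)"])
     (use assms in \<open>auto intro!: AE_I2 mult_left_mono occ_time_le\<close>)

lemma exp_moment_mono:
  assumes "0 \<le> \<gamma>" "0 \<le> s" "s \<le> t"
  shows "exp_moment P X i \<gamma> s \<le> exp_moment P X i \<gamma> t"
  unfolding exp_moment_def using assms
  by (intro integral_mono exp_occ_integrable) (auto intro!: mult_left_mono occ_time_mono)

text \<open>
  The occupation time grows at most at unit speed.
\<close>

lemma exp_moment_growth:
  assumes "0 \<le> \<gamma>" "0 \<le> s" "s \<le> t"
  shows "exp_moment P X i \<gamma> t \<le> exp (\<gamma> * (t - s)) * exp_moment P X i \<gamma> s"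
proof -
  have "exp_moment P X i \<gamma> t \<le> (\<integral>\<omega>. exp (\<gamma> * (t - s)) * exp (\<gamma> * occ_time X i s \<omega>) \<partial>P i)"
    unfolding exp_moment_def
  proof (intro integral_mono exp_occ_integrable integrable_mult_right)
    fix \<omega> assume "\<omega> \<in> space (P i)"
    then have "\<gamma> * occ_time X i t \<omega> \<le> \<gamma> * (occ_time X i s \<omega> + (t - s))"
      using assms by (intro mult_left_mono occ_time_increment_le)
    then show "exp (\<gamma> * occ_time X i t \<omega>) \<le> exp (\<gamma> * (t - s)) * exp (\<gamma> * occ_time X i s \<omega>)"
      by (simp add: exp_add[symmetric] algebra_simps)
  qed (use assms in auto)
  then show ?thesis by (simp add: exp_moment_def)
qed

lemma exp_moment_0: "exp_moment P X i \<gamma> 0 = 1"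
proof -
  have "exp_moment P X i \<gamma> 0 = (\<integral>\<omega>. 1 \<partial>P i)"
    unfolding exp_moment_def by (simp only: occ_time_0 mult_zero_right exp_zero)
  then show ?thesis by (simp add: Q.prob_space)
qed

lemma exp_moment_ge_1: "0 \<le> \<gamma> \<Longrightarrow> 0 \<le> t \<Longrightarrow> 1 \<le> exp_moment P X i \<gamma> t"
  using exp_moment_mono[of \<gamma> 0 t] by (simp add: exp_moment_0)

lemma exp_moment_series:
  assumes "0 \<le> \<gamma>" "0 \<le> t"
  shows "ennreal (exp_moment P X i \<gamma> t) = (\<Sum>n. ennreal (\<gamma> ^ n / fact n) * occ_moment n t)"
proof -
  have moment: "(\<integral>\<^sup>+\<omega>. occupation 0 t \<omega> ^ n \<partial>P i) = occ_moment n t" for n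
  proof -
    have start: "AE \<omega> in P i. stay {0} \<omega> = 1"
      using initial_state[OF state] by eventually_elim (simp add: stay_def visit_def)
    have "(\<integral>\<^sup>+\<omega>. occupation 0 t \<omega> ^ n \<partial>P i) = (\<integral>\<^sup>+\<omega>. stay {0} \<omega> * occupation 0 t \<omega> ^ n \<partial>P i)"
      by (rule nn_integral_cong_AE) (use start in eventually_elim, simp)
    also have "\<dots> = (\<integral>\<^sup>+\<omega>. stay {0} \<omega> \<partial>P i) * occ_moment n (t - 0)"
      by (rule nn_integral_stay_occupation_power) (use assms in auto)
    also have "(\<integral>\<^sup>+\<omega>. stay {0} \<omega> \<partial>P i) = (\<integral>\<^sup>+\<omega>. 1 \<partial>P i)"
      by (rule nn_integral_cong_AE) (use start in simp)
    finally show ?thesis by (simp add: Q.emeasure_space_1)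
  qed
  have "ennreal (exp_moment P X i \<gamma> t) = (\<integral>\<^sup>+\<omega>. ennreal (exp (\<gamma> * occ_time X i t \<omega>)) \<partial>P i)"
    unfolding exp_moment_def by (rule nn_integral_eq_integral[symmetric]) (use exp_occ_integrable assms in auto)
  also have "\<dots> = (\<integral>\<^sup>+\<omega>. (\<Sum>n. ennreal (\<gamma> ^ n / fact n) * occupation 0 t \<omega> ^ n) \<partial>P i)"
  proof (rule nn_integral_cong)
    fix \<omega> assume w: "\<omega> \<in> space (P i)"
    note L = occupation_eq_occ_time[OF w] occ_time_nonneg[OF w]
    have "(\<lambda>n. (\<gamma> * occ_time X i t \<omega>) ^ n /\<^sub>R fact n) sums exp (\<gamma> * occ_time X i t \<omega>)"
      by (rule exp_converges)
    then have "(\<Sum>n. ennreal ((\<gamma> * occ_time X i t \<omega>) ^ n /\<^sub>R fact n)) = ennreal (exp (\<gamma> * occ_time X i t \<omega>))"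
      using assms L(2) by (intro suminf_ennreal_eq) auto
    moreover have "ennreal ((\<gamma> * occ_time X i t \<omega>) ^ n /\<^sub>R fact n) = ennreal (\<gamma> ^ n / fact n) * occupation 0 t \<omega> ^ n" for n
      unfolding L(1) using assms L(2)
      by (simp add: ennreal_power ennreal_mult[symmetric] power_mult_distrib field_simps)
    ultimately show "ennreal (exp (\<gamma> * occ_time X i t \<omega>)) = (\<Sum>n. ennreal (\<gamma> ^ n / fact n) * occupation 0 t \<omega> ^ n)"
      by simp
  qed
  also have "\<dots> = (\<Sum>n. ennreal (\<gamma> ^ n / fact n) * (\<integral>\<^sup>+\<omega>. occupation 0 t \<omega> ^ n \<partial>P i))"
    by (subst nn_integral_suminf) (auto simp: nn_integral_cmult)
  also have "\<dots> = (\<Sum>n. ennreal (\<gamma> ^ n / fact n) * occ_moment n t)"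
    by (simp only: moment)
  finally show ?thesis .
qed

text \<open>
  The recursion that defines the moments, multiplied by \<open>\<gamma> ^ Suc n / fact (Suc n)\<close> and summed,
  reproduces the series inside the integral.
\<close>

lemma exp_moment_renewal:
  assumes "0 \<le> \<gamma>" "0 \<le> t"
  shows "ennreal (exp_moment P X i \<gamma> t) =
    1 + (\<integral>\<^sup>+u\<in>{0..t}. ennreal (\<gamma> * return_prob u * exp_moment P X i \<gamma> (t - u)) \<partial>lborel)"
proof -
  let ?a = "\<lambda>n. ennreal (\<gamma> ^ n / fact n)"
  have "ennreal (exp_moment P X i \<gamma> t) = (\<Sum>n. ?a n * occ_moment n t)"
    by (rule exp_moment_series[OF assms])
  also have "\<dots> = 1 + (\<Sum>n. ?a (Suc n) * occ_moment (Suc n) t)"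
    by (subst suminf_offset[of _ 1]) (auto simp: summableI)
  also have "(\<Sum>n. ?a (Suc n) * occ_moment (Suc n) t) =
     (\<Sum>n. \<integral>\<^sup>+u. ennreal (\<gamma> * return_prob u) * (?a n * occ_moment n (t - u)) * indicator {0..t} u \<partial>lborel)"
  proof (rule suminf_cong)
    fix n
    have "?a (Suc n) * of_nat (Suc n) = ?a (Suc n) * ennreal (real (Suc n))"
      unfolding ennreal_of_nat_eq_real_of_nat ..
    also have "\<dots> = ennreal (\<gamma> ^ Suc n / fact (Suc n) * real (Suc n))"
      by (rule ennreal_mult[symmetric]) (use assms in auto)
    also have "\<gamma> ^ Suc n / fact (Suc n) * real (Suc n) = \<gamma> * (\<gamma> ^ n / fact n)"
      unfolding fact_Suc by (simp del: of_nat_Suc)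
    also have "ennreal \<dots> = ennreal \<gamma> * ?a n"
      by (rule ennreal_mult) (use assms in auto)
    finally have c: "?a (Suc n) * of_nat (Suc n) = ennreal \<gamma> * ?a n" .
    have "?a (Suc n) * occ_moment (Suc n) t = ennreal \<gamma> * ?a n *
        (\<integral>\<^sup>+u\<in>{0..t}. ennreal (return_prob u) * occ_moment n (t - u) \<partial>lborel)"
      unfolding occ_moment.simps c[symmetric] by (simp only: mult.assoc)
    also have "\<dots> = (\<integral>\<^sup>+u. ennreal \<gamma> * ?a n * (ennreal (return_prob u) * occ_moment n (t - u) * indicator {0..t} u) \<partial>lborel)"
      by (rule nn_integral_cmult[symmetric]) measurable
    finally show "?a (Suc n) * occ_moment (Suc n) t =
      (\<integral>\<^sup>+u. ennreal (\<gamma> * return_prob u) * (?a n * occ_moment n (t - u)) * indicator {0..t} u \<partial>lborel)"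
      using assms by (simp add: ennreal_mult return_prob_nonneg ac_simps)
  qed
  also have "\<dots> = (\<integral>\<^sup>+u. (\<Sum>n. ennreal (\<gamma> * return_prob u) * (?a n * occ_moment n (t - u)) * indicator {0..t} u) \<partial>lborel)"
    by (rule nn_integral_suminf[symmetric]) measurable
  also have "\<dots> = (\<integral>\<^sup>+u\<in>{0..t}. ennreal (\<gamma> * return_prob u * exp_moment P X i \<gamma> (t - u)) \<partial>lborel)"
  proof (rule nn_integral_cong)
    fix u
    show "(\<Sum>n. ennreal (\<gamma> * return_prob u) * (?a n * occ_moment n (t - u)) * indicator {0..t} u)
      = ennreal (\<gamma> * return_prob u * exp_moment P X i \<gamma> (t - u)) * indicator {0..t} u"
    proof (cases "u \<in> {0..t}")
      case True
      then have "0 \<le> t - u" by simp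
      from exp_moment_series[OF assms(1) this] show ?thesis
        using True assms exp_moment_ge_1[OF assms(1) \<open>0 \<le> t - u\<close>]
        by (simp add: ennreal_suminf_cmult ennreal_mult return_prob_nonneg)
    qed simp
  qed
  finally show ?thesis .
qed

abbreviation moment :: "real \<Rightarrow> real \<Rightarrow> real" where
  "moment \<gamma> t \<equiv> exp_moment P X i \<gamma> t"

text \<open>
  Multiplication by \<open>exp (- l * t)\<close> preserves convolutions.  The tilted functions are extended by 0
  to negative times, as \<open>renewal_equation\<close> requires; \<open>l = 0\<close> gives the untilted equation.
\<close>

definition tilted_density :: "real \<Rightarrow> real \<Rightarrow> real \<Rightarrow> real" where
  "tilted_density \<gamma> l s = indicator {0..} s * (\<gamma> * exp (- l * s) * return_prob s)"

definition tilted_one :: "real \<Rightarrow> real \<Rightarrow> real" where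
  "tilted_one l t = indicator {0..} t * exp (- l * t)"

definition tilted_moment :: "real \<Rightarrow> real \<Rightarrow> real \<Rightarrow> real" where
  "tilted_moment \<gamma> l t = indicator {0..} t * (exp (- l * t) * moment \<gamma> (max 0 t))"

lemma tilted_renewal:
  assumes \<gamma>: "0 \<le> \<gamma>" and l: "0 \<le> l"
    and one: "(\<integral>\<^sup>+s\<in>{0..}. ennreal (\<gamma> * exp (- l * s) * return_prob s) \<partial>lborel) = 1"
  shows "renewal_equation (tilted_density \<gamma> l) (tilted_one l) (tilted_moment \<gamma> l)"
proof
  have M0: "0 \<le> moment \<gamma> t" if "0 \<le> t" for t using exp_moment_ge_1[OF \<gamma> that] by simp
  show "tilted_density \<gamma> l \<in> borel_measurable borel"
    unfolding tilted_density_def by measurable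
  show "tilted_one l \<in> borel_measurable borel"
    unfolding tilted_one_def by measurable
  have [measurable]: "(\<lambda>t. moment \<gamma> (max 0 t)) \<in> borel_measurable borel"
    by (intro borel_measurable_mono monoI exp_moment_mono \<gamma>) auto
  show "tilted_moment \<gamma> l \<in> borel_measurable borel"
    unfolding tilted_moment_def by measurable
  show "0 \<le> tilted_density \<gamma> l t" "0 \<le> tilted_one l t" "0 \<le> tilted_moment \<gamma> l t" for t
    using \<gamma> M0[of "max 0 t"] by (auto simp: tilted_density_def tilted_one_def tilted_moment_def return_prob_nonneg)
  show "tilted_density \<gamma> l t = 0" "tilted_one l t = 0" "tilted_moment \<gamma> l t = 0" if "t < 0" for t
    using that by (auto simp: tilted_density_def tilted_one_def tilted_moment_def)
  have "(\<integral>\<^sup>+s. ennreal (tilted_density \<gamma> l s) \<partial>lborel) = (\<integral>\<^sup>+s\<in>{0..}. ennreal (\<gamma> * exp (- l * s) * return_prob s) \<partial>lborel)"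
    by (intro nn_integral_cong) (auto simp: tilted_density_def indicator_def)
  then show "(\<integral>\<^sup>+s. ennreal (tilted_density \<gamma> l s) \<partial>lborel) = 1" using one by simp
  show "\<exists>B. \<forall>t\<le>T. tilted_moment \<gamma> l t \<le> B" for T
  proof (intro exI allI impI)
    fix t assume "t \<le> T"
    show "tilted_moment \<gamma> l t \<le> moment \<gamma> (max 0 T)"
    proof (cases "0 \<le> t")
      case True
      have "exp (- l * t) * moment \<gamma> t \<le> 1 * moment \<gamma> (max 0 T)"
        using \<gamma> l True M0 \<open>t \<le> T\<close> by (intro mult_mono exp_moment_mono) auto
      then show ?thesis using True by (simp add: tilted_moment_def)
    qed (use M0[of "max 0 T"] in \<open>simp add: tilted_moment_def\<close>)
  qed
  show "ennreal (tilted_moment \<gamma> l t) = ennreal (tilted_one l t)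
      + (\<integral>\<^sup>+s. ennreal (tilted_density \<gamma> l s * tilted_moment \<gamma> l (t - s)) \<partial>lborel)" if t: "0 \<le> t" for t
  proof -
    have "ennreal (tilted_moment \<gamma> l t) = ennreal (exp (- l * t)) * ennreal (moment \<gamma> t)"
      using t M0[OF t] by (simp add: tilted_moment_def ennreal_mult)
    also have "\<dots> = ennreal (exp (- l * t)) + ennreal (exp (- l * t)) *
        (\<integral>\<^sup>+u\<in>{0..t}. ennreal (\<gamma> * return_prob u * moment \<gamma> (t - u)) \<partial>lborel)"
      unfolding exp_moment_renewal[OF \<gamma> t] by (simp add: distrib_left)
    also have "ennreal (exp (- l * t)) * (\<integral>\<^sup>+u\<in>{0..t}. ennreal (\<gamma> * return_prob u * moment \<gamma> (t - u)) \<partial>lborel)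
      = ennreal (exp (- l * t)) * (\<integral>\<^sup>+u\<in>{0..t}. ennreal (\<gamma> * return_prob u * moment \<gamma> (max 0 (t - u))) \<partial>lborel)"
    proof -
      have "(\<integral>\<^sup>+u\<in>{0..t}. ennreal (\<gamma> * return_prob u * moment \<gamma> (t - u)) \<partial>lborel)
        = (\<integral>\<^sup>+u\<in>{0..t}. ennreal (\<gamma> * return_prob u * moment \<gamma> (max 0 (t - u))) \<partial>lborel)"
        by (rule nn_integral_cong) (auto simp: indicator_def)
      then show ?thesis by (simp only:)
    qed
    also have "\<dots> = (\<integral>\<^sup>+u. ennreal (exp (- l * t)) * (ennreal (\<gamma> * return_prob u * moment \<gamma> (max 0 (t - u))) * indicator {0..t} u) \<partial>lborel)"
      by (rule nn_integral_cmult[symmetric]) measurable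
    also have "\<dots> = (\<integral>\<^sup>+s. ennreal (tilted_density \<gamma> l s * tilted_moment \<gamma> l (t - s)) \<partial>lborel)"
    proof (rule nn_integral_cong)
      fix u
      show "ennreal (exp (- l * t)) * (ennreal (\<gamma> * return_prob u * moment \<gamma> (max 0 (t - u))) * indicator {0..t} u)
        = ennreal (tilted_density \<gamma> l u * tilted_moment \<gamma> l (t - u))"
      proof (cases "u \<in> {0..t}")
        case True
        have "exp (- l * t) = exp (- l * u) * exp (- l * (t - u))"
          by (simp add: exp_add[symmetric] algebra_simps)
        then have "exp (- l * t) * (\<gamma> * return_prob u * moment \<gamma> (max 0 (t - u)))
          = tilted_density \<gamma> l u * tilted_moment \<gamma> l (t - u)"
          using True by (simp add: tilted_density_def tilted_moment_def)
        then show ?thesis using True by (simp add: ennreal_mult'[symmetric])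
      qed (auto simp: tilted_density_def tilted_moment_def indicator_def)
    qed
    finally show ?thesis using t by (simp add: tilted_one_def)
  qed
qed

section \<open>The Laplace transform of the return probability\<close>

lemma return_prob_eq: "0 \<le> s \<Longrightarrow> trans_prob P X s i i = return_prob s"
  by (simp add: return_prob_def)

lemma green_eq: "green P X i = (\<integral>\<^sup>+s\<in>{0..}. ennreal (return_prob s) \<partial>lborel)"
  unfolding green_def by (intro nn_integral_cong) (auto simp: indicator_def return_prob_eq)

lemma
  assumes "l > 0"
  shows nn_integral_laplace: "(\<integral>\<^sup>+s\<in>{0..}. ennreal (exp (- l * s) * return_prob s) \<partial>lborel) = ennreal (laplace P X i l)"
    and nn_integral_laplace_complement: "(\<integral>\<^sup>+s\<in>{0..}. ennreal (exp (- l * s) * (1 - return_prob s)) \<partial>lborel) = ennreal (1 / l - laplace P X i l)"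
    and laplace_nonneg: "0 \<le> laplace P X i l"
    and laplace_le: "laplace P X i l \<le> 1 / l"
proof -
  let ?E = "\<lambda>s. indicator {0..} s *\<^sub>R exp (- l * s)" and ?Ep = "\<lambda>s. indicator {0..} s *\<^sub>R (exp (- l * s) * return_prob s)"
  have E: "(\<integral>\<^sup>+s. ennreal (?E s) \<partial>lborel) = ennreal (1 / l)"
  proof -
    have "(\<integral>\<^sup>+s. ennreal (?E s) \<partial>lborel) = (\<integral>\<^sup>+s\<in>{0..}. ennreal (s ^ 0 * exp (- l * s)) \<partial>lborel)"
      by (intro nn_integral_cong) (auto simp: indicator_def)
    then show ?thesis using nn_integral_power_exp[OF assms, of 0] by simp
  qed
  have intE: "integrable lborel ?E" by (rule integrableI_nonneg) (use E in auto)
  have valE: "(\<integral>s. ?E s \<partial>lborel) = 1 / l"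
    by (subst integral_eq_nn_integral) (use E assms in auto)
  have intEp: "integrable lborel ?Ep"
    by (rule Bochner_Integration.integrable_bound[OF intE])
       (auto simp: indicator_def return_prob_nonneg return_prob_le_1 abs_mult)
  have valEp: "(\<integral>s. ?Ep s \<partial>lborel) = laplace P X i l"
    unfolding laplace_def set_lebesgue_integral_def
    by (intro Bochner_Integration.integral_cong) (auto simp: indicator_def return_prob_eq)
  have "(\<integral>\<^sup>+s. ennreal (?Ep s) \<partial>lborel) = ennreal (laplace P X i l)"
    unfolding valEp[symmetric] by (rule nn_integral_eq_integral[OF intEp]) (auto simp: return_prob_nonneg)
  moreover have "(\<integral>\<^sup>+s. ennreal (?Ep s) \<partial>lborel) = (\<integral>\<^sup>+s\<in>{0..}. ennreal (exp (- l * s) * return_prob s) \<partial>lborel)"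
    by (intro nn_integral_cong) (auto simp: indicator_def)
  ultimately show "(\<integral>\<^sup>+s\<in>{0..}. ennreal (exp (- l * s) * return_prob s) \<partial>lborel) = ennreal (laplace P X i l)" by simp
  have "(\<integral>\<^sup>+s. ennreal (?E s - ?Ep s) \<partial>lborel) = ennreal (\<integral>s. ?E s - ?Ep s \<partial>lborel)"
    by (rule nn_integral_eq_integral[OF Bochner_Integration.integrable_diff[OF intE intEp]])
       (auto simp: indicator_def return_prob_le_1)
  also have "(\<integral>s. ?E s - ?Ep s \<partial>lborel) = 1 / l - laplace P X i l"
    unfolding Bochner_Integration.integral_diff[OF intE intEp] valE valEp ..
  also have "(\<integral>\<^sup>+s. ennreal (?E s - ?Ep s) \<partial>lborel) = (\<integral>\<^sup>+s\<in>{0..}. ennreal (exp (- l * s) * (1 - return_prob s)) \<partial>lborel)"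
    by (intro nn_integral_cong) (auto simp: indicator_def right_diff_distrib)
  finally show "(\<integral>\<^sup>+s\<in>{0..}. ennreal (exp (- l * s) * (1 - return_prob s)) \<partial>lborel) = ennreal (1 / l - laplace P X i l)" .
  show "0 \<le> laplace P X i l"
    unfolding valEp[symmetric] by (intro integral_nonneg_AE) (auto simp: return_prob_nonneg)
  show "laplace P X i l \<le> 1 / l"
    unfolding valEp[symmetric] valE[symmetric]
    by (intro integral_mono intE intEp) (auto simp: indicator_def return_prob_le_1)
qed

text \<open>
  The second claim holds because \<open>1 / l - laplace P X i l\<close> is the Laplace transform of the
  nonnegative function \<open>1 - return_prob\<close>.
\<close>

lemma laplace_antimono:
  assumes "0 < a" "a \<le> b"
  shows "laplace P X i b \<le> laplace P X i a"
    and "1 / b - laplace P X i b \<le> 1 / a - laplace P X i a"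
proof -
  have "0 < b" using assms by simp
  have e: "exp (- b * s) \<le> exp (- a * s)" if "0 \<le> s" for s
    using assms that by (simp add: mult_right_mono)
  have "ennreal (laplace P X i b) \<le> ennreal (laplace P X i a)"
    unfolding nn_integral_laplace[OF \<open>0 < a\<close>, symmetric] nn_integral_laplace[OF \<open>0 < b\<close>, symmetric]
  proof (intro nn_integral_mono)
    fix s show "ennreal (exp (- b * s) * return_prob s) * indicator {0..} s
        \<le> ennreal (exp (- a * s) * return_prob s) * indicator {0..} s"
      using mult_right_mono[OF e return_prob_nonneg[of s], of s] by (cases "0 \<le> s") (simp_all add: ennreal_leI)
  qed
  then show "laplace P X i b \<le> laplace P X i a"
    using laplace_nonneg[OF \<open>0 < a\<close>] by simp
  have "ennreal (1 / b - laplace P X i b) \<le> ennreal (1 / a - laplace P X i a)"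
    unfolding nn_integral_laplace_complement[OF \<open>0 < a\<close>, symmetric] nn_integral_laplace_complement[OF \<open>0 < b\<close>, symmetric]
  proof (intro nn_integral_mono)
    fix s show "ennreal (exp (- b * s) * (1 - return_prob s)) * indicator {0..} s
        \<le> ennreal (exp (- a * s) * (1 - return_prob s)) * indicator {0..} s"
      using mult_right_mono[OF e, of s "1 - return_prob s"] return_prob_le_1[of s]
      by (cases "0 \<le> s") (simp_all add: ennreal_leI)
  qed
  then show "1 / b - laplace P X i b \<le> 1 / a - laplace P X i a"
    using laplace_le[OF \<open>0 < a\<close>] by (subst (asm) ennreal_le_iff) auto
qed

text \<open>
  Both \<open>laplace P X i\<close> and its difference to \<open>1 / l\<close> are nonincreasing, so its increments are
  bounded by those of the continuous function \<open>1 / l\<close>.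
\<close>

lemma continuous_on_laplace: "continuous_on {0<..} (laplace P X i)"
proof (rule continuous_at_imp_continuous_on, rule ballI)
  fix x :: real assume "x \<in> {0<..}"
  then have x: "x > 0" by simp
  have "((\<lambda>y. 1 / y - 1 / x) \<longlongrightarrow> 1 / x - 1 / x) (at x)"
    using x by (intro tendsto_intros) auto
  then have lim: "((\<lambda>y. 1 / y - 1 / x) \<longlongrightarrow> 0) (at x)" by simp
  have "((\<lambda>y. laplace P X i y - laplace P X i x) \<longlongrightarrow> 0) (at x)"
  proof (rule Lim_null_comparison)
    have "eventually (\<lambda>y. y > 0) (at x)"
      using x by (intro order_tendstoD(1)[OF tendsto_ident_at])
    then show "eventually (\<lambda>y. norm (laplace P X i y - laplace P X i x) \<le> \<bar>1 / y - 1 / x\<bar>) (at x)"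
    proof eventually_elim
      case (elim y)
      show ?case
        using laplace_antimono[of x y] laplace_antimono[of y x] x elim by (cases "x \<le> y") auto
    qed
    show "((\<lambda>y. \<bar>1 / y - 1 / x\<bar>) \<longlongrightarrow> 0) (at x)"
      using tendsto_rabs[OF lim] by simp
  qed
  then show "isCont (laplace P X i) x" unfolding isCont_def by (rule LIM_zero_cancel)
qed

text \<open>
  Equality at two points would force \<open>return_prob\<close> to vanish almost everywhere.
\<close>

lemma laplace_strict_antimono:
  assumes "0 < a" "a < b" and G: "green P X i > 0"
  shows "laplace P X i b < laplace P X i a"
proof (rule ccontr)
  assume "\<not> ?thesis"
  then have eq: "laplace P X i b = laplace P X i a" using laplace_antimono(1)[of a b] assms by simp
  have "0 < b" using assms by simp
  have e: "exp (- b * s) \<le> exp (- a * s)" if "0 \<le> s" for s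
    using assms that by (simp add: mult_right_mono)
  let ?d = "\<lambda>s. ennreal ((exp (- a * s) - exp (- b * s)) * return_prob s) * indicator {0..} s"
  have "ennreal (laplace P X i b) + (\<integral>\<^sup>+s. ?d s \<partial>lborel) = ennreal (laplace P X i a)"
    unfolding nn_integral_laplace[OF \<open>0 < a\<close>, symmetric] nn_integral_laplace[OF \<open>0 < b\<close>, symmetric]
  proof (subst nn_integral_add[symmetric])
    show "(\<integral>\<^sup>+s. ennreal (exp (- b * s) * return_prob s) * indicator {0..} s + ?d s \<partial>lborel)
      = (\<integral>\<^sup>+s\<in>{0..}. ennreal (exp (- a * s) * return_prob s) \<partial>lborel)"
    proof (rule nn_integral_cong)
      fix s :: real
      show "ennreal (exp (- b * s) * return_prob s) * indicator {0..} s + ?d s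
        = ennreal (exp (- a * s) * return_prob s) * indicator {0..} s"
      proof (cases "0 \<le> s")
        case True
        have "0 \<le> exp (- b * s) * return_prob s" "0 \<le> (exp (- a * s) - exp (- b * s)) * return_prob s"
          using e[OF True] return_prob_nonneg[of s] by auto
        from ennreal_plus[OF this, symmetric] show ?thesis
          using True by (simp add: left_diff_distrib)
      qed simp
    qed
  qed measurable
  then have "(\<integral>\<^sup>+s. ?d s \<partial>lborel) = 0"
    unfolding eq using ennreal_add_left_cancel[of "ennreal (laplace P X i a)" _ 0] by simp
  then have "AE s in lborel. ?d s = 0"
    by (subst (asm) nn_integral_0_iff_AE) auto
  moreover have "AE s in lborel. s \<noteq> (0::real)" by (rule AE_lborel_singleton)
  ultimately have "AE s in lborel. ennreal (return_prob s) * indicator {0..} s = 0"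
  proof eventually_elim
    case (elim s)
    show ?case
    proof (cases "0 < s")
      case True
      then have "exp (- a * s) - exp (- b * s) > 0" using assms by simp
      then have "return_prob s \<le> 0"
        using elim(1) True return_prob_nonneg[of s] by (simp add: ennreal_eq_0_iff mult_le_0_iff)
      then show ?thesis by (simp add: ennreal_eq_0_iff)
    qed (use elim(2) in simp)
  qed
  then have "green P X i = (\<integral>\<^sup>+(s::real). 0 \<partial>lborel)"
    unfolding green_eq by (rule nn_integral_cong_AE)
  then show False using G by simp
qed

text \<open>
  Monotone convergence along \<open>l = 1 / Suc n\<close>.
\<close>

lemma laplace_tends_to_green:
  assumes "ennreal c < green P X i" "0 \<le> c"
  obtains a where "0 < a" "c < laplace P X i a"
proof -
  let ?e = "\<lambda>n s. ennreal (exp (- (1 / real (Suc n)) * s) * return_prob s) * indicator {0..} s"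
  have SUP: "(SUP n. ?e n s) = ennreal (return_prob s) * indicator {0..} s" for s
  proof (cases "0 \<le> s")
    case True
    have "(\<lambda>n. ennreal (exp (- (1 / real (Suc n)) * s) * return_prob s)) \<longlonglongrightarrow> ennreal (exp (- 0 * s) * return_prob s)"
      by (intro tendsto_ennrealI tendsto_intros LIMSEQ_Suc[OF lim_1_over_n])
    moreover have "incseq (\<lambda>n. ennreal (exp (- (1 / real (Suc n)) * s) * return_prob s))"
      using True by (intro incseq_SucI ennreal_leI mult_right_mono)
        (auto simp: return_prob_nonneg divide_left_mono)
    ultimately have "(SUP n. ennreal (exp (- (1 / real (Suc n)) * s) * return_prob s)) = ennreal (exp (- 0 * s) * return_prob s)"
      by (intro LIMSEQ_unique[OF LIMSEQ_SUP])
    then show ?thesis using True by simp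
  qed simp
  have "green P X i = (\<integral>\<^sup>+s. (SUP n. ?e n s) \<partial>lborel)" unfolding green_eq SUP ..
  also have "\<dots> = (SUP n. \<integral>\<^sup>+s. ?e n s \<partial>lborel)"
  proof (rule nn_integral_monotone_convergence_SUP)
    show "incseq ?e"
      by (intro incseq_SucI le_funI)
         (auto simp: indicator_def return_prob_nonneg divide_left_mono intro!: ennreal_leI mult_right_mono)
  qed measurable
  also have "\<dots> = (SUP n. ennreal (laplace P X i (1 / real (Suc n))))"
    by (intro SUP_cong refl nn_integral_laplace) simp
  finally obtain n where "ennreal c < ennreal (laplace P X i (1 / real (Suc n)))"
    using assms(1) by (auto simp: less_SUP_iff)
  then show thesis using assms(2) by (intro that[of "1 / real (Suc n)"]) (auto simp: ennreal_less_iff)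
qed

text \<open>
  The intermediate value theorem applies between a small \<open>a\<close> supplied by \<open>laplace_tends_to_green\<close>
  and \<open>\<gamma>\<close> itself, where the Laplace transform is at most \<open>1 / \<gamma>\<close>.
\<close>

lemma laplace_inv:
  assumes \<gamma>: "\<gamma> > 0" and G: "ennreal (1 / \<gamma>) < green P X i"
  shows "laplace_inv P X i (1 / \<gamma>) > 0" "laplace P X i (laplace_inv P X i (1 / \<gamma>)) = 1 / \<gamma>"
proof -
  obtain a where a: "0 < a" "1 / \<gamma> < laplace P X i a" using laplace_tends_to_green[OF G] \<gamma> by auto
  define b where "b = min a \<gamma>"
  have b: "0 < b" "b \<le> \<gamma>" "1 / \<gamma> \<le> laplace P X i b"
    using a \<gamma> laplace_antimono(1)[of b a] by (auto simp: b_def)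
  have "\<exists>x. b \<le> x \<and> x \<le> \<gamma> \<and> laplace P X i x = 1 / \<gamma>"
  proof (rule IVT2')
    show "laplace P X i \<gamma> \<le> 1 / \<gamma>" by (rule laplace_le[OF \<gamma>])
    show "continuous_on {b..\<gamma>} (laplace P X i)"
      by (rule continuous_on_subset[OF continuous_on_laplace]) (use b in auto)
  qed (use b in auto)
  then obtain l where l: "0 < l" "laplace P X i l = 1 / \<gamma>" using b less_le_trans by blast
  have "green P X i > 0" using G by (metis gr_zeroI not_less_zero)
  then have "inj_on (laplace P X i) {0<..}"
    using laplace_strict_antimono by (intro linorder_inj_onI) (force, auto)
  then have "laplace_inv P X i (1 / \<gamma>) = l"
    unfolding laplace_inv_def l(2)[symmetric] using l(1) by (intro the_inv_into_f_f) auto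
  then show "laplace_inv P X i (1 / \<gamma>) > 0" "laplace P X i (laplace_inv P X i (1 / \<gamma>)) = 1 / \<gamma>"
    using l by simp_all
qed

section \<open>The three regimes\<close>

text \<open>
  Tilting by the \<open>l\<close> at which the Laplace transform equals \<open>1 / \<gamma>\<close> turns \<open>\<gamma> * return_prob\<close> into a
  probability density with mean \<open>\<gamma>\<close> times the integral in the claim, and the key renewal theorem
  applies with \<open>z t = exp (- l * t)\<close>, whose integral is \<open>1 / l\<close>.
\<close>

lemma supercritical_asymptotics:
  assumes \<gamma>: "\<gamma> > 0" and l: "l > 0" and lap: "laplace P X i l = 1 / \<gamma>"
  shows "exp_moment P X i \<gamma> \<sim>[at_top]
    (\<lambda>t. 1 / (l * \<gamma> * (LINT s:{0..}|lborel. s * exp (- l * s) * trans_prob P X s i i)) * exp (l * t))"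
proof -
  let ?I = "LINT s:{0..}|lborel. s * exp (- l * s) * trans_prob P X s i i"
  have one: "(\<integral>\<^sup>+s\<in>{0..}. ennreal (\<gamma> * exp (- l * s) * return_prob s) \<partial>lborel) = 1"
  proof -
    have "(\<integral>\<^sup>+s\<in>{0..}. ennreal (\<gamma> * exp (- l * s) * return_prob s) \<partial>lborel)
      = (\<integral>\<^sup>+s. ennreal \<gamma> * (ennreal (exp (- l * s) * return_prob s) * indicator {0..} s) \<partial>lborel)"
      using \<gamma> by (intro nn_integral_cong) (simp add: ennreal_mult mult.assoc return_prob_nonneg)
    also have "\<dots> = ennreal \<gamma> * ennreal (1 / \<gamma>)"
      unfolding lap[symmetric] nn_integral_laplace[OF l, symmetric] by (rule nn_integral_cmult) measurable
    also have "\<dots> = 1" using \<gamma> by (simp add: ennreal_mult[symmetric])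
    finally show ?thesis .
  qed
  interpret renewal_equation "tilted_density \<gamma> l" "tilted_one l" "tilted_moment \<gamma> l"
    by (rule tilted_renewal) (use \<gamma> l one in auto)
  let ?h = "tilted_moment \<gamma> l"
  have M0: "0 \<le> moment \<gamma> t" if "0 \<le> t" for t using exp_moment_ge_1[of \<gamma> t] \<gamma> that by simp
  have h: "?h t = exp (- l * t) * moment \<gamma> t" if "0 \<le> t" for t using that by (simp add: tilted_moment_def)
  have z_nn: "(\<integral>\<^sup>+s. ennreal (tilted_one l s) \<partial>lborel) = ennreal (1 / l)"
  proof -
    have "(\<integral>\<^sup>+s. ennreal (tilted_one l s) \<partial>lborel) = (\<integral>\<^sup>+s\<in>{0..}. ennreal (s ^ 0 * exp (- l * s)) \<partial>lborel)"
      by (intro nn_integral_cong) (auto simp: indicator_def tilted_one_def)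
    then show ?thesis using nn_integral_power_exp[OF l, of 0] by simp
  qed
  have z_int: "integrable lborel (tilted_one l)"
    by (rule integrableI_nonneg) (use z_nn z_nonneg in auto)
  have z_val: "(\<integral>s. tilted_one l s \<partial>lborel) = 1 / l"
    by (subst integral_eq_nn_integral) (use z_nn z_nonneg l in auto)
  have mean: "mean = ennreal (\<gamma> * ?I)" and I0: "0 \<le> ?I"
  proof -
    let ?g = "\<lambda>s. indicator {0..} s *\<^sub>R (s * exp (- l * s) * return_prob s)"
    let ?e = "\<lambda>s. indicator {0..} s *\<^sub>R (s * exp (- l * s))"
    have "(\<integral>\<^sup>+s. ennreal (?e s) \<partial>lborel) = (\<integral>\<^sup>+s\<in>{0..}. ennreal (s ^ 1 * exp (- l * s)) \<partial>lborel)"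
      by (intro nn_integral_cong) (auto simp: indicator_def)
    also have "\<dots> < \<infinity>" by (subst nn_integral_power_exp[OF l]) simp
    finally have "integrable lborel ?e" by (intro integrableI_nonneg) (auto simp: indicator_def)
    then have g: "integrable lborel ?g"
      by (rule Bochner_Integration.integrable_bound)
         (auto simp: indicator_def return_prob_nonneg return_prob_le_1 abs_mult mult_left_le)
    have I: "(\<integral>s. ?g s \<partial>lborel) = ?I"
      unfolding set_lebesgue_integral_def
      by (intro Bochner_Integration.integral_cong) (auto simp: indicator_def return_prob_eq)
    show "0 \<le> ?I" unfolding I[symmetric]
      by (intro integral_nonneg_AE) (auto simp: indicator_def return_prob_nonneg)
    have "mean = (\<integral>\<^sup>+s. ennreal (\<gamma> * ?g s) \<partial>lborel)"
      unfolding mean_def by (intro nn_integral_cong) (auto simp: tilted_density_def indicator_def ac_simps)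
    also have "\<dots> = ennreal (\<integral>s. \<gamma> * ?g s \<partial>lborel)"
      by (rule nn_integral_eq_integral[OF integrable_mult_right[OF g]])
         (use \<gamma> in \<open>auto simp: indicator_def return_prob_nonneg\<close>)
    also have "(\<integral>s. \<gamma> * ?g s \<partial>lborel) = \<gamma> * ?I" by (simp only: integral_mult_right_zero I)
    finally show "mean = ennreal (\<gamma> * ?I)" .
  qed
  have I_pos: "?I > 0" using mean_pos I0 \<gamma> unfolding mean by (simp add: zero_less_mult_iff)
  \<comment> \<open>Over a time span \<open>d\<close>, \<open>h\<close> shrinks at most by \<open>exp (- l * d)\<close> and grows at most by
    \<open>exp (\<gamma> * d)\<close>; for a bounded function this implies a Lipschitz bound.\<close>
  have down: "exp (- l * d) * ?h s \<le> ?h t" if "0 \<le> s" "t = s + d" "0 \<le> d" for s t d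
  proof -
    have "exp (- l * t) * moment \<gamma> s \<le> exp (- l * t) * moment \<gamma> t"
      using that \<gamma> by (intro mult_left_mono exp_moment_mono) auto
    moreover have "exp (- l * t) = exp (- l * d) * exp (- l * s)"
      using that by (simp add: exp_add[symmetric] algebra_simps)
    ultimately show ?thesis using that by (simp add: h)
  qed
  have up: "exp (- \<gamma> * d) * ?h t \<le> ?h s" if "0 \<le> s" "t = s + d" "0 \<le> d" for s t d
  proof -
    have "exp (- \<gamma> * d) * (exp (- l * t) * moment \<gamma> t) \<le> exp (- \<gamma> * d) * (exp (- l * s) * (exp (\<gamma> * d) * moment \<gamma> s))"
      using that \<gamma> l M0 exp_moment_growth[of \<gamma> s t] by (intro mult_mono) (auto intro: mult_left_mono)
    also have "\<dots> = exp (- l * s) * moment \<gamma> s * (exp (- \<gamma> * d) * exp (\<gamma> * d))" by (simp only: ac_simps)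
    also have "exp (- \<gamma> * d) * exp (\<gamma> * d) = 1" by (simp add: exp_add[symmetric])
    finally show ?thesis using that by (simp add: h)
  qed
  obtain C where C: "?h t \<le> C" for t
  proof -
    have "exp (- l) = (\<integral>u. indicator {0..1} u *\<^sub>R exp (- l) \<partial>(lborel :: real measure))" by simp
    also have "\<dots> \<le> (\<integral>u. indicator {..1} u *\<^sub>R tilted_one l u \<partial>lborel)"
      using l by (intro integral_mono z_integrable_atMost integrable_scaleR_left integrable_real_indicator)
         (auto simp: indicator_def tilted_one_def emeasure_lborel_Icc_eq mult_left_le)
    finally have "0 < (\<integral>u. indicator {..1} u *\<^sub>R tilted_one l u \<partial>lborel)"
      using exp_gt_zero[of "- l"] by linarith
    from renewal_solution_bounded[OF z_int this, of l] show thesis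
      using l down that by auto
  qed
  have lip: "\<bar>?h t - ?h s\<bar> \<le> (C * (l + \<gamma>)) * (t - s)" if st: "0 \<le> s" "s \<le> t" for s t
  proof -
    have C0: "0 \<le> C" using C[of 0] h_nonneg[of 0] by linarith
    define d where "d = t - s"
    have d: "0 \<le> d" "t = s + d" using st by (auto simp: d_def)
    have bnd: "u - exp (- c * d) * u \<le> C * (c * d)" if "0 \<le> u" "u \<le> C" "0 \<le> c" for u c
    proof -
      have "1 - exp (- c * d) \<le> c * d" using exp_ge_add_one_self[of "- c * d"] by simp
      then have "u * (1 - exp (- c * d)) \<le> C * (c * d)" using that d C0 by (intro mult_mono) auto
      then show ?thesis by (simp add: algebra_simps)
    qed
    have 1: "?h s - ?h t \<le> C * (l * d)"
      using down[of s t d] bnd[of "?h s" l] h_nonneg C d l st by fastforce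
    have 2: "?h t - ?h s \<le> C * (\<gamma> * d)"
      using up[of s t d] bnd[of "?h t" \<gamma>] h_nonneg C d \<gamma> st by fastforce
    have "0 \<le> C * (l * d)" "0 \<le> C * (\<gamma> * d)" using C0 l \<gamma> d by auto
    moreover have "(C * (l + \<gamma>)) * (t - s) = C * (l * d) + C * (\<gamma> * d)" by (simp add: d_def algebra_simps)
    ultimately show ?thesis using 1 2 by linarith
  qed
  have lim: "(?h \<longlongrightarrow> (1 / l) / (\<gamma> * ?I)) at_top"
    using key_renewal_lipschitz[OF C lip z_int] I0 \<gamma> unfolding mean z_val by simp
  have "((\<lambda>t. ?h t * (l * \<gamma> * ?I)) \<longlongrightarrow> (1 / l) / (\<gamma> * ?I) * (l * \<gamma> * ?I)) at_top"
    by (intro tendsto_mult lim tendsto_const)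
  also have "(1 / l) / (\<gamma> * ?I) * (l * \<gamma> * ?I) = 1" using l \<gamma> I_pos by simp
  finally have "((\<lambda>t. ?h t * (l * \<gamma> * ?I)) \<longlongrightarrow> 1) at_top" .
  then have "((\<lambda>t. moment \<gamma> t / (1 / (l * \<gamma> * ?I) * exp (l * t))) \<longlongrightarrow> 1) at_top"
  proof (rule Lim_transform_eventually)
    show "eventually (\<lambda>t. ?h t * (l * \<gamma> * ?I) = moment \<gamma> t / (1 / (l * \<gamma> * ?I) * exp (l * t))) at_top"
      using eventually_ge_at_top[of 0]
      by eventually_elim (simp add: h exp_minus field_simps)
  qed
  then show ?thesis by (rule asymp_equivI')
qed

text \<open>
  Here \<open>\<gamma> * return_prob\<close> already has total mass 1, so the tilt is \<open>l = 0\<close>.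
\<close>

lemma critical_renewal:
  assumes \<gamma>: "\<gamma> > 0" and G: "green P X i = ennreal (1 / \<gamma>)"
  shows "renewal_equation (tilted_density \<gamma> 0) (tilted_one 0) (tilted_moment \<gamma> 0)"
proof (rule tilted_renewal)
  have "(\<integral>\<^sup>+s\<in>{0..}. ennreal (\<gamma> * exp (- 0 * s) * return_prob s) \<partial>lborel)
      = (\<integral>\<^sup>+s. ennreal \<gamma> * (ennreal (return_prob s) * indicator {0..} s) \<partial>lborel)"
    using \<gamma> by (intro nn_integral_cong) (simp add: ennreal_mult mult.assoc return_prob_nonneg)
  also have "\<dots> = ennreal \<gamma> * green P X i"
    unfolding green_eq by (rule nn_integral_cmult) measurable
  also have "\<dots> = 1" using \<gamma> unfolding G by (simp add: ennreal_mult[symmetric])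
  finally show "(\<integral>\<^sup>+s\<in>{0..}. ennreal (\<gamma> * exp (- 0 * s) * return_prob s) \<partial>lborel) = 1" .
qed (use \<gamma> in auto)

text \<open>
  The denominator \<open>\<gamma> * A\<close> is the truncated mean of the density \<open>\<gamma> * return_prob\<close>, so the bounds hold
  at every \<open>t > 0\<close>, not only in the limit.
\<close>

lemma critical_bounds:
  assumes \<gamma>: "\<gamma> > 0" and G: "green P X i = ennreal (1 / \<gamma>)" and t: "t > 0"
  defines "A \<equiv> LINT s:{0..t}|lborel. (LINT r:{s..}|lborel. trans_prob P X r i i)"
  shows "1 \<le> moment \<gamma> t / (t / (\<gamma> * A))" "moment \<gamma> t / (t / (\<gamma> * A)) \<le> 2"
proof -
  interpret renewal_equation "tilted_density \<gamma> 0" "tilted_one 0" "tilted_moment \<gamma> 0"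
    by (rule critical_renewal[OF \<gamma> G])
  have tail: "tail s = \<gamma> * (LINT r:{s..}|lborel. trans_prob P X r i i)" if "0 \<le> s" for s
  proof -
    have "tail s = (\<integral>r. \<gamma> * (indicator {s..} r *\<^sub>R trans_prob P X r i i) \<partial>lborel)"
      unfolding tail_def set_lebesgue_integral_def
    proof (rule integral_cong_AE)
      have "AE r in lborel. r \<noteq> s" by (rule AE_lborel_singleton)
      then show "AE r in lborel. indicator {s<..} r *\<^sub>R tilted_density \<gamma> 0 r = \<gamma> * (indicator {s..} r *\<^sub>R trans_prob P X r i i)"
        by eventually_elim (use that in \<open>auto simp: indicator_def tilted_density_def return_prob_eq\<close>)
      have "(\<lambda>r. \<gamma> * (indicator {s..} r *\<^sub>R return_prob r)) \<in> borel_measurable lborel" by measurable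
      also have "(\<lambda>r. \<gamma> * (indicator {s..} r *\<^sub>R return_prob r)) = (\<lambda>r. \<gamma> * (indicator {s..} r *\<^sub>R trans_prob P X r i i))"
        using that by (auto simp: indicator_def return_prob_eq fun_eq_iff)
      finally show "(\<lambda>r. \<gamma> * (indicator {s..} r *\<^sub>R trans_prob P X r i i)) \<in> borel_measurable lborel" .
    qed measurable
    then show ?thesis unfolding set_lebesgue_integral_def by (simp only: integral_mult_right_zero)
  qed
  have "truncated_mean t = (LINT s:{0..t}|lborel. \<gamma> * (LINT r:{s..}|lborel. trans_prob P X r i i))"
    unfolding truncated_mean_def set_lebesgue_integral_def[where A="{0..t}"]
    by (intro Bochner_Integration.integral_cong refl) (auto simp: indicator_def tail)
  then have tm: "truncated_mean t = \<gamma> * A" by (simp add: A_def)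
  have z: "tilted_one 0 t = 1" if "0 \<le> t" for t using that by (simp add: tilted_one_def)
  have mono: "tilted_moment \<gamma> 0 s \<le> tilted_moment \<gamma> 0 t" if "s \<le> t" for s t
    using that exp_moment_mono[of \<gamma> "max 0 s" "max 0 t"] exp_moment_ge_1[of \<gamma> t] \<gamma>
    by (auto simp: tilted_moment_def indicator_def)
  have h: "tilted_moment \<gamma> 0 t = moment \<gamma> t" using t by (simp add: tilted_moment_def)
  have lo: "t \<le> moment \<gamma> t * (\<gamma> * A)"
    using le_renewal_times_truncated_mean[OF z mono, of t] t unfolding tm h by simp
  have up: "moment \<gamma> t * (\<gamma> * A) \<le> 2 * t"
    using renewal_times_truncated_mean_le[OF z mono, of t t] t unfolding tm h by simp
  have eq: "moment \<gamma> t / (t / (\<gamma> * A)) = moment \<gamma> t * (\<gamma> * A) / t" by simp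
  show "1 \<le> moment \<gamma> t / (t / (\<gamma> * A))" unfolding eq using lo t by (simp add: pos_le_divide_eq)
  show "moment \<gamma> t / (t / (\<gamma> * A)) \<le> 2" unfolding eq using up t by (simp add: pos_divide_le_eq)
qed

lemma critical_asymptotics:
  assumes \<gamma>: "\<gamma> > 0" and G: "green P X i = ennreal (1 / \<gamma>)" and H: "green_moment P X i < \<infinity>"
  shows "exp_moment P X i \<gamma> \<sim>[at_top] (\<lambda>t. t / (\<gamma> * enn2real (green_moment P X i)))"
proof -
  interpret renewal_equation "tilted_density \<gamma> 0" "tilted_one 0" "tilted_moment \<gamma> 0"
    by (rule critical_renewal[OF \<gamma> G])
  let ?H = "enn2real (green_moment P X i)"
  have "mean = (\<integral>\<^sup>+s. ennreal \<gamma> * (ennreal (s * return_prob s) * indicator {0..} s) \<partial>lborel)"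
    unfolding mean_def using \<gamma>
    by (intro nn_integral_cong)
       (auto simp: tilted_density_def indicator_def ennreal_mult[symmetric] return_prob_nonneg ac_simps)
  also have "\<dots> = ennreal \<gamma> * (\<integral>\<^sup>+s\<in>{0..}. ennreal (s * return_prob s) \<partial>lborel)"
    by (rule nn_integral_cmult) measurable
  also have "(\<integral>\<^sup>+s\<in>{0..}. ennreal (s * return_prob s) \<partial>lborel) = green_moment P X i"
    unfolding green_moment_def by (intro nn_integral_cong) (auto simp: indicator_def return_prob_eq)
  finally have mean: "mean = ennreal \<gamma> * green_moment P X i" .
  then have fin: "mean < \<infinity>" using H by (simp add: ennreal_mult_less_top)
  have m: "enn2real mean = \<gamma> * ?H" unfolding mean using \<gamma> by (simp add: enn2real_mult)
  have pos: "0 < \<gamma> * ?H" unfolding m[symmetric] using mean_pos fin by (simp add: enn2real_positive_iff)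
  have z: "tilted_one 0 t = 1" if "0 \<le> t" for t using that by (simp add: tilted_one_def)
  have mono: "tilted_moment \<gamma> 0 s \<le> tilted_moment \<gamma> 0 t" if "s \<le> t" for s t
    using that exp_moment_mono[of \<gamma> "max 0 s" "max 0 t"] exp_moment_ge_1[of \<gamma> t] \<gamma>
    by (auto simp: tilted_moment_def indicator_def)
  have "((\<lambda>t. tilted_moment \<gamma> 0 t / t * (\<gamma> * ?H)) \<longlongrightarrow> 1 / (\<gamma> * ?H) * (\<gamma> * ?H)) at_top"
    using elementary_renewal[OF z mono fin] unfolding m by (intro tendsto_mult tendsto_const)
  also have "1 / (\<gamma> * ?H) * (\<gamma> * ?H) = 1" using pos by (auto simp: zero_less_mult_iff)
  finally have "((\<lambda>t. moment \<gamma> t / (t / (\<gamma> * ?H))) \<longlongrightarrow> 1) at_top"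
  proof (rule Lim_transform_eventually)
    show "eventually (\<lambda>t. tilted_moment \<gamma> 0 t / t * (\<gamma> * ?H) = moment \<gamma> t / (t / (\<gamma> * ?H))) at_top"
      using eventually_gt_at_top[of 0] by eventually_elim (simp add: tilted_moment_def)
  qed
  then show ?thesis by (rule asymp_equivI')
qed

text \<open>
  By monotonicity the renewal equation gives \<open>moment \<gamma> t \<le> 1 + \<gamma> * g * moment \<gamma> t\<close>, hence boundedness and
  convergence; dominated convergence in the renewal equation identifies the limit.
\<close>

lemma subcritical_limit:
  assumes \<gamma>: "0 \<le> \<gamma>" and G: "green P X i = ennreal g" and g: "0 \<le> g" "\<gamma> * g < 1"
  shows "(exp_moment P X i \<gamma> \<longlongrightarrow> 1 / (1 - \<gamma> * g)) at_top"
proof -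
  let ?w = "\<lambda>s. indicator {0..} s *\<^sub>R (\<gamma> * return_prob s)"
  define h where "h t = indicator {0..} t * moment \<gamma> (max 0 t)" for t
  have Mmono: "moment \<gamma> s \<le> moment \<gamma> t" if "0 \<le> s" "s \<le> t" for s t using exp_moment_mono that \<gamma> by blast
  have M1: "1 \<le> moment \<gamma> t" if "0 \<le> t" for t using exp_moment_ge_1 that \<gamma> by blast
  have [measurable]: "(\<lambda>t. moment \<gamma> (max 0 t)) \<in> borel_measurable borel"
    by (intro borel_measurable_mono monoI Mmono) auto
  have [measurable]: "h \<in> borel_measurable borel" unfolding h_def by measurable
  have w_nn: "(\<integral>\<^sup>+s. ennreal (?w s) \<partial>lborel) = ennreal (\<gamma> * g)"
  proof -
    have "(\<integral>\<^sup>+s. ennreal (?w s) \<partial>lborel) = (\<integral>\<^sup>+s. ennreal \<gamma> * (ennreal (return_prob s) * indicator {0..} s) \<partial>lborel)"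
      using \<gamma> by (intro nn_integral_cong) (auto simp: indicator_def ennreal_mult return_prob_nonneg)
    also have "\<dots> = ennreal \<gamma> * green P X i"
      unfolding green_eq by (rule nn_integral_cmult) measurable
    finally show ?thesis using \<gamma> g by (simp add: G ennreal_mult)
  qed
  have w0: "0 \<le> ?w s" for s using \<gamma> by (simp add: return_prob_nonneg)
  have w: "integrable lborel ?w" by (rule integrableI_nonneg) (use w_nn w0 in auto)
  have w_val: "(\<integral>s. ?w s \<partial>lborel) = \<gamma> * g"
    by (subst integral_eq_nn_integral) (use w_nn w0 \<gamma> g in auto)
  have h0: "0 \<le> h t" for t using M1[of "max 0 t"] by (simp add: h_def)
  have h_le: "h s \<le> h t" if "s \<le> t" for s t
    using that Mmono[of "max 0 s" "max 0 t"] M1[of t] by (auto simp: h_def indicator_def)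
  have wh: "integrable lborel (\<lambda>s. ?w s * h (t - s))" for t
  proof (rule Bochner_Integration.integrable_bound[where f="\<lambda>s. ?w s * h t"])
    show "integrable lborel (\<lambda>s. ?w s * h t)" by (intro integrable_mult_left w)
    have "norm (?w s * h (t - s)) \<le> norm (?w s * h t)" for s
      using w0[of s] h0[of t] h0[of "t - s"] h_le[of "t - s" t]
      by (cases "0 \<le> s") (auto simp: abs_mult intro!: mult_left_mono)
    then show "AE s in lborel. norm (?w s * h (t - s)) \<le> norm (?w s * h t)" by simp
  qed measurable
  have ren: "h t = 1 + (\<integral>s. ?w s * h (t - s) \<partial>lborel)" if t: "0 \<le> t" for t
  proof -
    have "ennreal (h t) = 1 + (\<integral>\<^sup>+u\<in>{0..t}. ennreal (\<gamma> * return_prob u * moment \<gamma> (t - u)) \<partial>lborel)"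
      using exp_moment_renewal[OF \<gamma> t] t by (simp add: h_def)
    also have "(\<integral>\<^sup>+u\<in>{0..t}. ennreal (\<gamma> * return_prob u * moment \<gamma> (t - u)) \<partial>lborel)
        = (\<integral>\<^sup>+s. ennreal (?w s * h (t - s)) \<partial>lborel)"
      by (intro nn_integral_cong) (auto simp: indicator_def h_def)
    also have "\<dots> = ennreal (\<integral>s. ?w s * h (t - s) \<partial>lborel)"
      by (rule nn_integral_eq_integral[OF wh]) (use w0 h0 in auto)
    also have "1 + \<dots> = ennreal (1 + (\<integral>s. ?w s * h (t - s) \<partial>lborel))"
      using w0 h0 by (subst ennreal_plus) (auto intro!: integral_nonneg_AE)
    finally show ?thesis
      using w0 h0 by (subst (asm) ennreal_inj) (auto intro!: integral_nonneg_AE add_nonneg_nonneg)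
  qed
  have bound: "h t \<le> 1 / (1 - \<gamma> * g)" for t
  proof (cases "0 \<le> t")
    case True
    have "(\<integral>s. ?w s * h (t - s) \<partial>lborel) \<le> (\<integral>s. ?w s * h t \<partial>lborel)"
    proof (intro integral_mono wh integrable_mult_left w)
      fix s show "?w s * h (t - s) \<le> ?w s * h t"
        using w0[of s] h_le[of "t - s" t] by (cases "0 \<le> s") (auto intro!: mult_left_mono)
    qed
    also have "\<dots> = \<gamma> * g * h t" by (simp only: integral_mult_left_zero w_val)
    finally have "h t * (1 - \<gamma> * g) \<le> 1" using ren[OF True] by (simp add: algebra_simps)
    then show ?thesis using g by (simp add: pos_le_divide_eq)
  qed (use g in \<open>simp add: h_def\<close>)
  define m where "m = (SUP t. h t)"
  have bdd: "bdd_above (range h)" by (rule bdd_aboveI2) (rule bound)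
  have h_m: "h t \<le> m" for t unfolding m_def by (intro cSUP_upper bdd) simp
  have lim: "(h \<longlongrightarrow> m) at_top"
  proof (rule increasing_tendsto)
    show "eventually (\<lambda>t. h t \<le> m) at_top" by (simp add: h_m)
    fix x assume "x < m"
    then obtain t where t: "x < h t" unfolding m_def using less_cSUP_iff[of UNIV h x] bdd by auto
    show "eventually (\<lambda>t. x < h t) at_top"
      using eventually_ge_at_top[of t] by eventually_elim (use t h_le less_le_trans in blast)
  qed
  have "((\<lambda>t. \<integral>s. ?w s * h (t - s) \<partial>lborel) \<longlongrightarrow> (\<integral>s. ?w s * m \<partial>lborel)) at_top"
  proof (rule integral_dominated_convergence_at_top[where w="\<lambda>s. ?w s * m"])
    show "integrable lborel (\<lambda>s. ?w s * m)" by (intro integrable_mult_left w)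
    show "AE s in lborel. ((\<lambda>t. ?w s * h (t - s)) \<longlongrightarrow> ?w s * m) at_top"
      using tendsto_at_top_shift[OF lim, of "- s" for s] by (intro AE_I2 tendsto_mult tendsto_const) simp
    show "eventually (\<lambda>t. AE s in lborel. norm (?w s * h (t - s)) \<le> ?w s * m) at_top"
    proof (intro always_eventually allI AE_I2)
      fix t s
      have "norm (?w s * h (t - s)) = ?w s * h (t - s)"
        using w0[of s] h0[of "t - s"] by (metis mult_nonneg_nonneg real_norm_def abs_of_nonneg)
      also have "\<dots> \<le> ?w s * m" by (intro mult_left_mono h_m w0)
      finally show "norm (?w s * h (t - s)) \<le> ?w s * m" .
    qed
  qed measurable
  then have "((\<lambda>t. 1 + (\<integral>s. ?w s * h (t - s) \<partial>lborel)) \<longlongrightarrow> 1 + \<gamma> * g * m) at_top"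
    unfolding integral_mult_left_zero w_val by (intro tendsto_add tendsto_const)
  then have "(h \<longlongrightarrow> 1 + \<gamma> * g * m) at_top"
    by (rule Lim_transform_eventually) (rule eventually_mono[OF eventually_ge_at_top[of 0]], simp only: ren)
  then have "m = 1 + \<gamma> * g * m" using lim by (intro tendsto_unique[OF trivial_limit_at_top_linorder])
  then have "m * (1 - \<gamma> * g) = 1" by (simp add: algebra_simps)
  then have "m = 1 / (1 - \<gamma> * g)" using g by (simp add: eq_divide_eq)
  moreover have "((\<lambda>t. moment \<gamma> t) \<longlongrightarrow> m) at_top"
    using lim by (rule Lim_transform_eventually)
      (rule eventually_mono[OF eventually_ge_at_top[of 0]], simp add: h_def)
  ultimately show ?thesis by simp
qed

end

section \<open>The phase transition in the interaction strength\<close>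

theorem theorem1:
  fixes S :: "'s set"
    and \<Omega> :: "'w measure"
    and P :: "'s \<Rightarrow> 'w measure"
    and X :: "real \<Rightarrow> 'w \<Rightarrow> 's"
    and i :: 's
    and \<gamma> :: real
  assumes "markov_process S \<Omega> P X"
    and "i \<in> S"
  shows "(ennreal \<gamma> > 1 / green P X i \<longrightarrow>
            laplace_inv P X i (1 / \<gamma>) > 0 \<and>
            exp_moment P X i \<gamma> \<sim>[at_top]
              (\<lambda>t. 1 / (laplace_inv P X i (1 / \<gamma>) * \<gamma> *
                        (LINT s:{0..}|lborel.
                           s * exp (- laplace_inv P X i (1 / \<gamma>) * s) * trans_prob P X s i i))
                   * exp (laplace_inv P X i (1 / \<gamma>) * t)))
       \<and> (\<gamma> > 0 \<and> ennreal \<gamma> = 1 / green P X i \<longrightarrow>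
            (let g = (\<lambda>t. t / (\<gamma> * (LINT s:{0..t}|lborel.
                                      (LINT r:{s..}|lborel. trans_prob P X r i i))))
             in 1 \<le> Liminf at_top (\<lambda>t. ereal (exp_moment P X i \<gamma> t / g t)) \<and>
                Liminf at_top (\<lambda>t. ereal (exp_moment P X i \<gamma> t / g t))
                  \<le> Limsup at_top (\<lambda>t. ereal (exp_moment P X i \<gamma> t / g t)) \<and>
                Limsup at_top (\<lambda>t. ereal (exp_moment P X i \<gamma> t / g t)) \<le> 2) \<and>
            (green_moment P X i < \<infinity> \<longrightarrow>
               exp_moment P X i \<gamma> \<sim>[at_top]
                 (\<lambda>t. t / (\<gamma> * enn2real (green_moment P X i)))))
       \<and> (0 \<le> \<gamma> \<and> ennreal \<gamma> < 1 / green P X i \<longrightarrow>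
            (exp_moment P X i \<gamma> \<longlongrightarrow> 1 / (1 - \<gamma> * enn2real (green P X i))) at_top)"
proof (intro conjI impI)
  interpret markov_state S \<Omega> P X i
    using assms by (intro markov_state.intro markov_state_axioms.intro)
  let ?G = "green P X i"
  {
    assume super: "ennreal \<gamma> > 1 / ?G"
    then have "ennreal \<gamma> > 0" by (rule le_less_trans[rotated]) simp
    then have \<gamma>: "\<gamma> > 0" by simp
    have G: "ennreal (1 / \<gamma>) < ?G" using super inverse_ennreal_less_iff[OF \<gamma>] by simp
    show "laplace_inv P X i (1 / \<gamma>) > 0" by (rule laplace_inv(1)[OF \<gamma> G])
    show "exp_moment P X i \<gamma> \<sim>[at_top]
              (\<lambda>t. 1 / (laplace_inv P X i (1 / \<gamma>) * \<gamma> *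
                        (LINT s:{0..}|lborel.
                           s * exp (- laplace_inv P X i (1 / \<gamma>) * s) * trans_prob P X s i i))
                   * exp (laplace_inv P X i (1 / \<gamma>) * t))"
      by (rule supercritical_asymptotics[OF \<gamma> laplace_inv[OF \<gamma> G]])
  }
  {
    assume crit: "\<gamma> > 0 \<and> ennreal \<gamma> = 1 / ?G"
    then have \<gamma>: "\<gamma> > 0" and G: "?G = ennreal (1 / \<gamma>)"
      using eq_inverse_ennreal_iff[of \<gamma> ?G] by auto
    let ?g = "\<lambda>t. t / (\<gamma> * (LINT s:{0..t}|lborel. (LINT r:{s..}|lborel. trans_prob P X r i i)))"
    have "1 \<le> Liminf at_top (\<lambda>t. ereal (exp_moment P X i \<gamma> t / ?g t))"
      by (intro Liminf_bounded eventually_mono[OF eventually_gt_at_top[of 0]])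
         (simp only: critical_bounds(1)[OF \<gamma> G] one_ereal_def ereal_less_eq)
    moreover have "Liminf at_top (\<lambda>t. ereal (exp_moment P X i \<gamma> t / ?g t))
        \<le> Limsup at_top (\<lambda>t. ereal (exp_moment P X i \<gamma> t / ?g t))"
      by (rule Liminf_le_Limsup) simp
    moreover have "Limsup at_top (\<lambda>t. ereal (exp_moment P X i \<gamma> t / ?g t)) \<le> ereal 2"
      by (intro Limsup_bounded eventually_mono[OF eventually_gt_at_top[of 0]])
         (simp only: critical_bounds(2)[OF \<gamma> G] ereal_less_eq)
    ultimately show "let g = ?g in
        1 \<le> Liminf at_top (\<lambda>t. ereal (exp_moment P X i \<gamma> t / g t)) \<and>
        Liminf at_top (\<lambda>t. ereal (exp_moment P X i \<gamma> t / g t))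
          \<le> Limsup at_top (\<lambda>t. ereal (exp_moment P X i \<gamma> t / g t)) \<and>
        Limsup at_top (\<lambda>t. ereal (exp_moment P X i \<gamma> t / g t)) \<le> 2"
      unfolding Let_def by simp
    show "exp_moment P X i \<gamma> \<sim>[at_top] (\<lambda>t. t / (\<gamma> * enn2real (green_moment P X i)))"
      if "green_moment P X i < \<infinity>"
      by (rule critical_asymptotics[OF \<gamma> G that])
  }
  {
    assume sub: "0 \<le> \<gamma> \<and> ennreal \<gamma> < 1 / ?G"
    then have "?G \<noteq> top" by (auto simp: ennreal_divide_top)
    then obtain g where g: "0 \<le> g" "?G = ennreal g" by (cases ?G) auto
    have "\<gamma> * g < 1"
    proof (cases "g = 0")
      case False
      with g have pos: "0 < g" by simp
      with g have "1 / ?G = ennreal (1 / g)"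
        by (subst ennreal_1[symmetric], subst g(2), subst divide_ennreal) auto
      then show ?thesis using sub pos by (auto simp: ennreal_less_iff pos_less_divide_eq)
    qed simp
    then show "(exp_moment P X i \<gamma> \<longlongrightarrow> 1 / (1 - \<gamma> * enn2real ?G)) at_top"
      using subcritical_limit[of \<gamma> g] sub g by simp
  }
qed

end
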